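(* Let $A$ be a formula of first-order logic (in negation normal form, over a signature of relation symbols and function symbols containing at least one constant symbol, without equality). Then $A$ is valid if and only if $A$ has an Herbrand proof.
   Context: Setting. Pure first-order logic (no equality, no nonlogical axioms) over a signature of relation symbols and function symbols containing at least one constant symbol. Formulae are always in negation normal form: built from atoms and negated atoms with $\land,\lor,\forall,\exists$, the negation of a general formula being given by the De Morgan laws. Formulae are considered modulo renaming of bound variables ($\alpha$-equivalence). A formula is alpha-normal if, for each variable $x$, it contains at most one occurrence of a quantifier $\forall x$ or $\exists x$; every formula is $\alpha$-equivalent to an alpha-normal one. Bound variables are chosen distinct from free variables, so that no capture occurs. A formula is in prenex normal form if it has the form $Q.M$ with $Q$ a sequence of quantifiers and $M$ quantifier-free; $M$ is its matrix. Strong $\lor$-expansion. A strong $\lor$-expansion of a formula $A$ is any formula obtained from $A$ by finitely many (possibly zero) applications of the following operation: in the current strong $\lor$-expansion $A'$ of $A$, replace a subformula occurrence $B$ whose outermost connective is an existential quantifier by $B\lor B$. (Bound variables may then be renamed to make the result alpha-normal.) Prenexification. A prenexification of an alpha-normal formula $A$ is a formula in prenex normal form derived from $A$ by successive applications of the operations $(qx.A)*B \rightsquigarrow qx.(A*B)$ and $A*(qx.B)\rightsquigarrow qx.(A*B)$, with $q\in\{\forall,\exists\}$ and $*\in\{\land,\lor\}$ (applied to subformulae). Witnessing substitution. Let $A$ be a valid alpha-normal formula in prenex normal form with $r\ge 0$ existential quantifiers, so that $A$ has the form $$(\forall x_1\cdots\forall x_{n_1})(\exists y_1)(\forall x_{n_1+1}\cdots\forall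 x_{n_2})(\exists y_2)\cdots(\exists y_r)(\forall x_{n_r+1}\cdots\forall x_{n_{r+1}})\,B(\bar x,\bar y)$$ with $B$ quantifier-free and $0\le n_1\le n_2\le\cdots\le n_{r+1}$. A witnessing substitution for $A$ is a sequence of terms $t_1,\dots,t_r$ such that (1) each $t_i$ may contain arbitrary free variables but, among bound variables, only variables from $x_1,\dots,x_{n_i}$; and (2) the formula $B(\bar x,t_1,\dots,t_r)$ is a (propositional) tautology. Herbrand proof of a formula. An Herbrand proof of a formula $A$ consists of a prenexification $A^*$ of a strong $\lor$-expansion of $A$, together with a witnessing substitution $\sigma$ for $A^*$. *)

theory Defs
  imports Main
begin

datatype 'f trm = Var nat | Fn 'f "'f trm list"

text \<open>Negation is only applied to atoms: \<open>Neg p ts\<close> is the negated atom.\<close>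

datatype ('f, 'p) fm =
    Pos 'p "'f trm list"
  | Neg 'p "'f trm list"
  | And "('f, 'p) fm" "('f, 'p) fm"
  | Or "('f, 'p) fm" "('f, 'p) fm"
  | All nat "('f, 'p) fm"
  | Ex nat "('f, 'p) fm"

text \<open>
  All elements of \<open>'f\<close> and \<open>'p\<close> are symbols of the signature; constants are the function symbols
  of arity 0.
\<close>

record ('f, 'p) signature =
  fun_arity :: "'f \<Rightarrow> nat"
  rel_arity :: "'p \<Rightarrow> nat"

fun wf_trm :: "('f, 'p) signature \<Rightarrow> 'f trm \<Rightarrow> bool" where
  "wf_trm S (Var x) \<longleftrightarrow> True"
| "wf_trm S (Fn f ts) \<longleftrightarrow> length ts = fun_arity S f \<and> (\<forall>t\<in>set ts. wf_trm S t)"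

fun wf_fm :: "('f, 'p) signature \<Rightarrow> ('f, 'p) fm \<Rightarrow> bool" where
  "wf_fm S (Pos p ts) \<longleftrightarrow> length ts = rel_arity S p \<and> (\<forall>t\<in>set ts. wf_trm S t)"
| "wf_fm S (Neg p ts) \<longleftrightarrow> length ts = rel_arity S p \<and> (\<forall>t\<in>set ts. wf_trm S t)"
| "wf_fm S (And A B) \<longleftrightarrow> wf_fm S A \<and> wf_fm S B"
| "wf_fm S (Or A B) \<longleftrightarrow> wf_fm S A \<and> wf_fm S B"
| "wf_fm S (All x A) \<longleftrightarrow> wf_fm S A"
| "wf_fm S (Ex x A) \<longleftrightarrow> wf_fm S A"


section \<open>Semantics\<close>

record ('f, 'p, 'u) interp =
  universe :: "'u set"
  fn :: "'f \<Rightarrow> 'u list \<Rightarrow> 'u"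
  rel :: "'p \<Rightarrow> 'u list \<Rightarrow> bool"

definition is_interp :: "('f, 'p) signature \<Rightarrow> ('f, 'p, 'u) interp \<Rightarrow> bool" where
  "is_interp S M \<longleftrightarrow> universe M \<noteq> {} \<and>
     (\<forall>f us. length us = fun_arity S f \<and> set us \<subseteq> universe M \<longrightarrow> fn M f us \<in> universe M)"

fun eval :: "('f, 'p, 'u) interp \<Rightarrow> (nat \<Rightarrow> 'u) \<Rightarrow> 'f trm \<Rightarrow> 'u" where
  "eval M e (Var x) = e x"
| "eval M e (Fn f ts) = fn M f (map (eval M e) ts)"

fun sat :: "('f, 'p, 'u) interp \<Rightarrow> (nat \<Rightarrow> 'u) \<Rightarrow> ('f, 'p) fm \<Rightarrow> bool" where
  "sat M e (Pos p ts) \<longleftrightarrow> rel M p (map (eval M e) ts)"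
| "sat M e (Neg p ts) \<longleftrightarrow> \<not> rel M p (map (eval M e) ts)"
| "sat M e (And A B) \<longleftrightarrow> sat M e A \<and> sat M e B"
| "sat M e (Or A B) \<longleftrightarrow> sat M e A \<or> sat M e B"
| "sat M e (All x A) \<longleftrightarrow> (\<forall>u\<in>universe M. sat M (e(x := u)) A)"
| "sat M e (Ex x A) \<longleftrightarrow> (\<exists>u\<in>universe M. sat M (e(x := u)) A)"

text \<open>
  HOL cannot quantify over all domains in a formula, so validity is relative to a type \<open>'u\<close>: the
  domains are all nonempty subsets of \<open>'u\<close>, finite ones included. By the downward
  Loewenheim-Skolem theorem, the notion is the same for every infinite \<open>'u\<close>.
\<close>

definition valid :: "'u itself \<Rightarrow> ('f, 'p) signature \<Rightarrow> ('f, 'p) fm \<Rightarrow> bool" where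
  "valid _ S A \<longleftrightarrow> (\<forall>(M :: ('f, 'p, 'u) interp) e.
     is_interp S M \<and> range e \<subseteq> universe M \<longrightarrow> sat M e A)"


section \<open>Variables, substitution and renaming of bound variables\<close>

fun vars_trm :: "'f trm \<Rightarrow> nat set" where
  "vars_trm (Var x) = {x}"
| "vars_trm (Fn f ts) = (\<Union>t\<in>set ts. vars_trm t)"

fun free_vars :: "('f, 'p) fm \<Rightarrow> nat set" where
  "free_vars (Pos p ts) = (\<Union>t\<in>set ts. vars_trm t)"
| "free_vars (Neg p ts) = (\<Union>t\<in>set ts. vars_trm t)"
| "free_vars (And A B) = free_vars A \<union> free_vars B"
| "free_vars (Or A B) = free_vars A \<union> free_vars B"
| "free_vars (All x A) = free_vars A - {x}"
| "free_vars (Ex x A) = free_vars A - {x}"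

text \<open>One entry for each quantifier occurrence.\<close>

fun bound_vars :: "('f, 'p) fm \<Rightarrow> nat list" where
  "bound_vars (Pos p ts) = []"
| "bound_vars (Neg p ts) = []"
| "bound_vars (And A B) = bound_vars A @ bound_vars B"
| "bound_vars (Or A B) = bound_vars A @ bound_vars B"
| "bound_vars (All x A) = x # bound_vars A"
| "bound_vars (Ex x A) = x # bound_vars A"

definition alpha_normal :: "('f, 'p) fm \<Rightarrow> bool" where
  "alpha_normal A \<longleftrightarrow> distinct (bound_vars A)"

definition bound_free_disjoint :: "('f, 'p) fm \<Rightarrow> bool" where
  "bound_free_disjoint A \<longleftrightarrow> set (bound_vars A) \<inter> free_vars A = {}"

fun subst_trm :: "(nat \<Rightarrow> 'f trm) \<Rightarrow> 'f trm \<Rightarrow> 'f trm" where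
  "subst_trm \<sigma> (Var x) = \<sigma> x"
| "subst_trm \<sigma> (Fn f ts) = Fn f (map (subst_trm \<sigma>) ts)"

text \<open>
  Simultaneous substitution for the free occurrences of variables. It does not avoid capture; it
  is only used to insert a fresh variable and on quantifier-free formulae.
\<close>

fun subst_fm :: "(nat \<Rightarrow> 'f trm) \<Rightarrow> ('f, 'p) fm \<Rightarrow> ('f, 'p) fm" where
  "subst_fm \<sigma> (Pos p ts) = Pos p (map (subst_trm \<sigma>) ts)"
| "subst_fm \<sigma> (Neg p ts) = Neg p (map (subst_trm \<sigma>) ts)"
| "subst_fm \<sigma> (And A B) = And (subst_fm \<sigma> A) (subst_fm \<sigma> B)"
| "subst_fm \<sigma> (Or A B) = Or (subst_fm \<sigma> A) (subst_fm \<sigma> B)"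
| "subst_fm \<sigma> (All x A) = All x (subst_fm (\<sigma>(x := Var x)) A)"
| "subst_fm \<sigma> (Ex x A) = Ex x (subst_fm (\<sigma>(x := Var x)) A)"

text \<open>\<open>in_context R A B\<close>: \<open>B\<close> results from \<open>A\<close> by applying \<open>R\<close> to one subformula occurrence.\<close>

inductive in_context ::
    "(('f, 'p) fm \<Rightarrow> ('f, 'p) fm \<Rightarrow> bool) \<Rightarrow> ('f, 'p) fm \<Rightarrow> ('f, 'p) fm \<Rightarrow> bool"
  for R where
  here: "R A B \<Longrightarrow> in_context R A B"
| AndL: "in_context R A B \<Longrightarrow> in_context R (And A C) (And B C)"
| AndR: "in_context R A B \<Longrightarrow> in_context R (And C A) (And C B)"
| OrL: "in_context R A B \<Longrightarrow> in_context R (Or A C) (Or B C)"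
| OrR: "in_context R A B \<Longrightarrow> in_context R (Or C A) (Or C B)"
| All: "in_context R A B \<Longrightarrow> in_context R (All x A) (All x B)"
| Ex: "in_context R A B \<Longrightarrow> in_context R (Ex x A) (Ex x B)"

inductive rename_bound :: "('f, 'p) fm \<Rightarrow> ('f, 'p) fm \<Rightarrow> bool" where
  All: "y \<notin> free_vars A \<union> set (bound_vars A) \<Longrightarrow>
    rename_bound (All x A) (All y (subst_fm (Var(x := Var y)) A))"
| Ex: "y \<notin> free_vars A \<union> set (bound_vars A) \<Longrightarrow>
    rename_bound (Ex x A) (Ex y (subst_fm (Var(x := Var y)) A))"

definition alpha_equiv :: "('f, 'p) fm \<Rightarrow> ('f, 'p) fm \<Rightarrow> bool" where
  "alpha_equiv = equivclp (in_context rename_bound)"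


section \<open>Strong \<open>\<or>\<close>-expansions and prenexifications\<close>

inductive duplicate_ex :: "('f, 'p) fm \<Rightarrow> ('f, 'p) fm \<Rightarrow> bool" where
  "duplicate_ex (Ex x B) (Or (Ex x B) (Ex x B))"

definition strong_or_expansion :: "('f, 'p) fm \<Rightarrow> ('f, 'p) fm \<Rightarrow> bool" where
  "strong_or_expansion A E \<longleftrightarrow> (\<exists>A'. (in_context duplicate_ex)\<^sup>*\<^sup>* A A' \<and> alpha_equiv A' E)"

text \<open>
  The rules need no freshness condition: they are only used starting from alpha-normal formulae
  whose bound variables are distinct from the free ones, where no capture can occur.
\<close>

inductive pull_quantifier :: "('f, 'p) fm \<Rightarrow> ('f, 'p) fm \<Rightarrow> bool" where
  "pull_quantifier (And (All x A) B) (All x (And A B))"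
| "pull_quantifier (And (Ex x A) B) (Ex x (And A B))"
| "pull_quantifier (Or (All x A) B) (All x (Or A B))"
| "pull_quantifier (Or (Ex x A) B) (Ex x (Or A B))"
| "pull_quantifier (And A (All x B)) (All x (And A B))"
| "pull_quantifier (And A (Ex x B)) (Ex x (And A B))"
| "pull_quantifier (Or A (All x B)) (All x (Or A B))"
| "pull_quantifier (Or A (Ex x B)) (Ex x (Or A B))"

fun matrix :: "('f, 'p) fm \<Rightarrow> ('f, 'p) fm" where
  "matrix (All x A) = matrix A"
| "matrix (Ex x A) = matrix A"
| "matrix A = A"

definition quantifier_free :: "('f, 'p) fm \<Rightarrow> bool" where
  "quantifier_free A \<longleftrightarrow> bound_vars A = []"

definition prenex :: "('f, 'p) fm \<Rightarrow> bool" where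
  "prenex A \<longleftrightarrow> quantifier_free (matrix A)"

definition prenexification :: "('f, 'p) fm \<Rightarrow> ('f, 'p) fm \<Rightarrow> bool" where
  "prenexification A A' \<longleftrightarrow> alpha_normal A \<and> bound_free_disjoint A \<and>
     (in_context pull_quantifier)\<^sup>*\<^sup>* A A' \<and> prenex A'"


section \<open>Herbrand proofs\<close>

text \<open>
  Atoms are treated as propositional variables. The values on quantified formulae are junk, and
  excluded in \<open>tautology\<close>.
\<close>

fun prop_eval :: "('p \<Rightarrow> 'f trm list \<Rightarrow> bool) \<Rightarrow> ('f, 'p) fm \<Rightarrow> bool" where
  "prop_eval v (Pos p ts) \<longleftrightarrow> v p ts"
| "prop_eval v (Neg p ts) \<longleftrightarrow> \<not> v p ts"
| "prop_eval v (And A B) \<longleftrightarrow> prop_eval v A \<and> prop_eval v B"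
| "prop_eval v (Or A B) \<longleftrightarrow> prop_eval v A \<or> prop_eval v B"
| "prop_eval v (All x A) \<longleftrightarrow> False"
| "prop_eval v (Ex x A) \<longleftrightarrow> False"

definition tautology :: "('f, 'p) fm \<Rightarrow> bool" where
  "tautology A \<longleftrightarrow> quantifier_free A \<and> (\<forall>v. prop_eval v A)"

text \<open>
  For a prenex formula, \<open>ex_scopes {} A\<close> lists the existential variables \<open>y\<^sub>1, \<dots>, y\<^sub>r\<close> of the
  prefix, each \<open>y\<^sub>i\<close> paired with the set \<open>{x\<^sub>1, \<dots>, x\<^bsub>n\<^sub>i\<^esub>}\<close> of universal variables to its left.
\<close>

fun ex_scopes :: "nat set \<Rightarrow> ('f, 'p) fm \<Rightarrow> (nat \<times> nat set) list" where
  "ex_scopes X (All x A) = ex_scopes (insert x X) A"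
| "ex_scopes X (Ex y A) = (y, X) # ex_scopes X A"
| "ex_scopes X A = []"

text \<open>The substitution with \<open>y\<^sub>i \<mapsto> t\<^sub>i\<close> that is the identity elsewhere.\<close>

definition subst_of :: "nat list \<Rightarrow> 'f trm list \<Rightarrow> nat \<Rightarrow> 'f trm" where
  "subst_of ys ts x = (case map_of (zip ys ts) x of None \<Rightarrow> Var x | Some t \<Rightarrow> t)"

text \<open>
  Validity of \<open>A\<close> is not presupposed: it is a consequence of the existence of such terms.
\<close>

definition witnessing_substitution ::
    "('f, 'p) signature \<Rightarrow> ('f, 'p) fm \<Rightarrow> 'f trm list \<Rightarrow> bool" where
  "witnessing_substitution S A ts \<longleftrightarrow>
     alpha_normal A \<and> bound_free_disjoint A \<and> prenex A \<and>
     length ts = length (ex_scopes {} A) \<and>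
     (\<forall>i < length ts. wf_trm S (ts ! i) \<and>
        vars_trm (ts ! i) \<inter> set (bound_vars A) \<subseteq> snd (ex_scopes {} A ! i)) \<and>
     tautology (subst_fm (subst_of (map fst (ex_scopes {} A)) ts) (matrix A))"

definition herbrand_proof ::
    "('f, 'p) signature \<Rightarrow> ('f, 'p) fm \<Rightarrow> ('f, 'p) fm \<Rightarrow> 'f trm list \<Rightarrow> bool" where
  "herbrand_proof S A A' ts \<longleftrightarrow>
     (\<exists>E. strong_or_expansion A E \<and> prenexification E A') \<and> witnessing_substitution S A' ts"

end

theory Submission
  imports Defs "HOL-Library.Nat_Bijection" "HOL-Library.Countable_Set"
begin

text \<open>
  A Herbrand proof is sound because each stage preserves truth: duplicating an existential
  subformula, renaming bound variables and, in the absence of capture, pulling quantifiers are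
  equivalences, and a witnessing substitution says how to choose the existential values of the
  prenex formula, one after the other from left to right, so that its matrix becomes an instance of
  a tautology (\<open>sat_prenex_by_witnesses\<close>).

  For the converse, a valid \<open>A\<close> is expanded exhaustively. Let \<open>T\<close> enumerate all terms that serve as
  witnesses. For each \<open>K\<close>, every existential subformula is replaced by \<open>K + 1\<close> copies, also inside the
  copies; copy number \<open>i\<close> is meant to receive the witness \<open>T i\<close>. The result is made alpha-normal by
  naming every quantifier after its position, and the names are numbers chosen such that

    \<^item> they increase on the way from the root of the formula to the leaves,
    \<^item> the name of copy number \<open>i\<close> of an existential exceeds all variables of \<open>T i\<close>,
    \<^item> existential names do not occur in any \<open>T i\<close>.

  By the first property, the quantifiers can be pulled to the front in the order of their names
  (\<open>sorted_prefix_exists\<close>); by the other two, a bound variable that occurs in a witness is then a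
  universal one quantified further to the left. So the expansion for \<open>K\<close> gives a Herbrand proof as soon
  as the instance of its matrix is a tautology (\<open>herbrand_proof_of_holds\<close>). The truth of this instance
  under a valuation is described by \<open>holds\<close>.

  It remains to see that some \<open>K\<close> works. If every \<open>K\<close> has a falsifying valuation, then by
  compactness one valuation falsifies the instances for all \<open>K\<close> at once
  (\<open>uniform_countervaluation\<close>). It determines a term model, whose universe is the range of \<open>T\<close>, and
  there \<open>A\<close> is false: an existential is false because all its instances are, a universal because its
  eigenvariable, an element of the model, refutes it (\<open>model_falsifies\<close>). The terms are built from
  finitely many function symbols, so the model can be copied into any infinite type, and \<open>A\<close> is not
  valid there.
\<close>

section \<open>Semantics of substitution, renaming and quantifier shifts\<close>

lemma eval_cong: "(\<And>x. x \<in> vars_trm t \<Longrightarrow> e x = e' x) \<Longrightarrow> eval M e t = eval M e' t"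
proof (induction t)
  case (Fn f ts)
  then have "map (eval M e) ts = map (eval M e') ts" by auto
  then show ?case by (simp only: eval.simps)
qed simp

lemma eval_fresh_upd: "x \<notin> vars_trm t \<Longrightarrow> eval M (e(x := u)) t = eval M e t"
  by (rule eval_cong) auto

lemma sat_cong: "(\<And>x. x \<in> free_vars A \<Longrightarrow> e x = e' x) \<Longrightarrow> sat M e A \<longleftrightarrow> sat M e' A"
proof (induction A arbitrary: e e')
  case (Pos p ts)
  then have "map (eval M e) ts = map (eval M e') ts" by (auto intro!: eval_cong)
  then show ?case by (simp only: sat.simps)
next
  case (Neg p ts)
  then have "map (eval M e) ts = map (eval M e') ts" by (auto intro!: eval_cong)
  then show ?case by (simp only: sat.simps)
next
  case (And A B)
  then show ?case by (metis UnCI free_vars.simps(3) sat.simps(3))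
next
  case (Or A B)
  then show ?case by (metis UnCI free_vars.simps(4) sat.simps(4))
next
  case (All x A)
  have "sat M (e(x := u)) A \<longleftrightarrow> sat M (e'(x := u)) A" for u
    by (rule All.IH) (use All.prems in auto)
  then show ?case by simp
next
  case (Ex x A)
  have "sat M (e(x := u)) A \<longleftrightarrow> sat M (e'(x := u)) A" for u
    by (rule Ex.IH) (use Ex.prems in auto)
  then show ?case by simp
qed

lemma eval_subst_trm: "eval M e (subst_trm \<sigma> t) = eval M (\<lambda>x. eval M e (\<sigma> x)) t"
  by (induction t) (auto cong: map_cong)

lemma sat_fresh_upd: "x \<notin> free_vars A \<Longrightarrow> sat M (e(x := u)) A \<longleftrightarrow> sat M e A"
  by (rule sat_cong) auto

text \<open>
  The assumption excludes capture. A variable may be free and also bound elsewhere in \<open>A\<close>, but none of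
  its free occurrences lies below its own binder, whence the exception \<open>z = b\<close>.
\<close>

lemma sat_subst_fm:
  assumes "\<And>z b. z \<in> free_vars A \<Longrightarrow> b \<in> set (bound_vars A) \<Longrightarrow> z \<noteq> b \<Longrightarrow> b \<notin> vars_trm (\<sigma> z)"
  shows "sat M e (subst_fm \<sigma> A) \<longleftrightarrow> sat M (\<lambda>x. eval M e (\<sigma> x)) A"
  using assms
proof (induction A arbitrary: e \<sigma>)
  case (All x A)
  have "sat M (e(x := u)) (subst_fm (\<sigma>(x := Var x)) A) \<longleftrightarrow> sat M ((\<lambda>x. eval M e (\<sigma> x))(x := u)) A" for u
  proof -
    have "sat M (e(x := u)) (subst_fm (\<sigma>(x := Var x)) A)
        \<longleftrightarrow> sat M (\<lambda>z. eval M (e(x := u)) ((\<sigma>(x := Var x)) z)) A"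
      by (rule All.IH) (use All.prems in \<open>auto split: if_splits\<close>)
    also have "\<dots> \<longleftrightarrow> sat M ((\<lambda>x. eval M e (\<sigma> x))(x := u)) A"
      by (rule sat_cong) (use All.prems in \<open>auto intro!: eval_cong\<close>)
    finally show ?thesis .
  qed
  then show ?case by simp
next
  case (Ex x A)
  have "sat M (e(x := u)) (subst_fm (\<sigma>(x := Var x)) A) \<longleftrightarrow> sat M ((\<lambda>x. eval M e (\<sigma> x))(x := u)) A" for u
  proof -
    have "sat M (e(x := u)) (subst_fm (\<sigma>(x := Var x)) A)
        \<longleftrightarrow> sat M (\<lambda>z. eval M (e(x := u)) ((\<sigma>(x := Var x)) z)) A"
      by (rule Ex.IH) (use Ex.prems in \<open>auto split: if_splits\<close>)
    also have "\<dots> \<longleftrightarrow> sat M ((\<lambda>x. eval M e (\<sigma> x))(x := u)) A"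
      by (rule sat_cong) (use Ex.prems in \<open>auto intro!: eval_cong\<close>)
    finally show ?thesis .
  qed
  then show ?case by simp
qed (auto simp: eval_subst_trm comp_def)

lemma sat_in_context:
  assumes "in_context R A B" and "\<And>A B e. R A B \<Longrightarrow> sat M e A \<longleftrightarrow> sat M e B"
  shows "sat M e A \<longleftrightarrow> sat M e B"
  using assms(1) by (induction arbitrary: e) (auto simp: assms(2))

lemma sat_duplicate_ex: "duplicate_ex A B \<Longrightarrow> sat M e A \<longleftrightarrow> sat M e B"
  by (auto elim: duplicate_ex.cases)

lemma sat_rename_var:
  assumes "y \<notin> free_vars A \<union> set (bound_vars A)"
  shows "sat M (e(y := u)) (subst_fm (Var(x := Var y)) A) \<longleftrightarrow> sat M (e(x := u)) A"
proof -
  have "sat M (e(y := u)) (subst_fm (Var(x := Var y)) A)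
      \<longleftrightarrow> sat M (\<lambda>z. eval M (e(y := u)) ((Var(x := Var y)) z)) A"
    by (rule sat_subst_fm) (use assms in auto)
  also have "\<dots> \<longleftrightarrow> sat M (e(x := u)) A"
    by (rule sat_cong) (use assms in auto)
  finally show ?thesis .
qed

lemma sat_rename_bound: "rename_bound A B \<Longrightarrow> sat M e A \<longleftrightarrow> sat M e B"
  by (erule rename_bound.cases) (simp_all add: sat_rename_var)

lemma sat_alpha_equiv:
  assumes "alpha_equiv A B"
  shows "sat M e A \<longleftrightarrow> sat M e B"
  using assms unfolding alpha_equiv_def
  by (induction rule: equivclp_induct)
    (use sat_in_context[of rename_bound, OF _ sat_rename_bound] in blast)+

lemma sat_strong_or_expansion:
  assumes "strong_or_expansion A E"
  shows "sat M e A \<longleftrightarrow> sat M e E"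
proof -
  obtain A' where d: "(in_context duplicate_ex)\<^sup>*\<^sup>* A A'" and a: "alpha_equiv A' E"
    using assms unfolding strong_or_expansion_def by blast
  from d have "sat M e A \<longleftrightarrow> sat M e A'"
    by induction (use sat_in_context[of duplicate_ex, OF _ sat_duplicate_ex] in blast)+
  with sat_alpha_equiv[OF a] show ?thesis by blast
qed

text \<open>
  Pulling past \<open>B\<close> needs that the variable is not free in \<open>B\<close>. This is not implied by the rules but by
  the two conditions on \<open>A\<close>, which must therefore be carried along. They are inherited by subformulae:
  a variable that becomes free when its quantifier is dropped has no second binder. A universal is
  pulled out of a conjunction only over a nonempty universe, and likewise an existential out of a
  disjunction.
\<close>

lemma pull_quantifier_invariants:
  assumes "in_context pull_quantifier A B" "alpha_normal A" "bound_free_disjoint A"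
  shows "alpha_normal B \<and> set (bound_vars B) = set (bound_vars A) \<and> free_vars B = free_vars A \<and>
    (universe M \<noteq> {} \<longrightarrow> (\<forall>e. sat M e A \<longleftrightarrow> sat M e B))"
  using assms
proof (induction)
  case (here A B)
  then show ?case
    by cases (auto simp: alpha_normal_def bound_free_disjoint_def sat_fresh_upd)
qed (fastforce simp: alpha_normal_def bound_free_disjoint_def)+

lemma sat_pull_quantifiers:
  assumes "(in_context pull_quantifier)\<^sup>*\<^sup>* A B" "alpha_normal A" "bound_free_disjoint A"
    and "universe M \<noteq> {}"
  shows "sat M e A \<longleftrightarrow> sat M e B"
proof -
  have "alpha_normal B \<and> bound_free_disjoint B \<and> (sat M e A \<longleftrightarrow> sat M e B)"
    using assms(1)
  proof induction
    case base
    then show ?case using assms by simp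
  next
    case (step B C)
    then show ?case
      using pull_quantifier_invariants[OF step.hyps(2), of M] assms(4)
      by (auto simp: bound_free_disjoint_def)
  qed
  then show ?thesis by blast
qed

section \<open>Soundness of witnessing substitutions\<close>

lemma eval_in_universe:
  assumes "is_interp S M" "wf_trm S t" "range e \<subseteq> universe M"
  shows "eval M e t \<in> universe M"
  using assms(2)
proof (induction t)
  case (Var x)
  then show ?case using assms(3) by auto
next
  case (Fn f ts)
  then show ?case using assms(1) unfolding is_interp_def by (simp add: image_subset_iff)
qed

lemma bound_vars_subst_fm [simp]: "bound_vars (subst_fm \<sigma> A) = bound_vars A"
  by (induction A arbitrary: \<sigma>) auto

lemma sat_eq_prop_eval:
  "bound_vars A = [] \<Longrightarrow> sat M e A \<longleftrightarrow> prop_eval (\<lambda>p ts. rel M p (map (eval M e) ts)) A"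
  by (induction A) auto

lemma ex_scopes_var_bound: "z \<in> fst ` set (ex_scopes X A) \<Longrightarrow> z \<in> set (bound_vars A)"
  by (induction X A rule: ex_scopes.induct) auto

lemma distinct_ex_scopes_vars:
  "distinct (bound_vars A) \<Longrightarrow> distinct (map fst (ex_scopes X A))"
  by (induction X A rule: ex_scopes.induct) (use ex_scopes_var_bound in force)+

lemma sat_of_tautology_instance:
  assumes "tautology (subst_fm \<theta> (matrix A))" and "\<And>z. e z = eval M e (\<theta> z)" and "matrix A = A"
  shows "sat M e A"
proof -
  have qf: "bound_vars A = []"
    using assms(1,3) by (simp add: tautology_def quantifier_free_def)
  then have "sat M e (subst_fm \<theta> A)"
    using assms(1,3) by (simp add: sat_eq_prop_eval tautology_def)
  also have "sat M e (subst_fm \<theta> A) \<longleftrightarrow> sat M (\<lambda>x. eval M e (\<theta> x)) A"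
    by (rule sat_subst_fm) (simp add: qf)
  also have "(\<lambda>x. eval M e (\<theta> x)) = e" using assms(2) by auto
  finally show ?thesis .
qed

text \<open>
  \<open>Z\<close> collects the existential variables that have already been given a value. Each of them denotes
  the value of its witness, and it keeps doing so when the remaining quantifiers are instantiated:
  their variables do not occur in that witness, being bound but outside of its scope.
\<close>

lemma sat_prenex_by_witnesses:
  assumes "is_interp S M"
    and "distinct (bound_vars A)" "prenex A" "X \<inter> set (bound_vars A) = {}"
    and "\<And>y Y. (y, Y) \<in> set (ex_scopes X A) \<Longrightarrow>
      wf_trm S (\<theta> y) \<and> vars_trm (\<theta> y) \<inter> set (bound_vars A) \<subseteq> Y"
    and "\<And>z. z \<in> Z \<Longrightarrow> e z = eval M e (\<theta> z) \<and> vars_trm (\<theta> z) \<inter> set (bound_vars A) = {}"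
    and "\<And>z. z \<notin> Z \<Longrightarrow> z \<notin> fst ` set (ex_scopes X A) \<Longrightarrow> \<theta> z = Var z"
    and "tautology (subst_fm \<theta> (matrix A))"
    and "range e \<subseteq> universe M"
    and "Z \<inter> set (bound_vars A) = {}"
  shows "sat M e A"
proof -
  have quantifier_free: "sat M e B"
    if "tautology (subst_fm \<theta> (matrix B))" "matrix B = B" "ex_scopes X B = []"
      and Z: "\<And>z. z \<in> Z \<Longrightarrow> e z = eval M e (\<theta> z) \<and> vars_trm (\<theta> z) \<inter> set (bound_vars B) = {}"
      and nZ: "\<And>z. z \<notin> Z \<Longrightarrow> z \<notin> fst ` set (ex_scopes X B) \<Longrightarrow> \<theta> z = Var z"
    for B X Z e
  proof (rule sat_of_tautology_instance[OF that(1) _ that(2)])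
    show "e z = eval M e (\<theta> z)" for z
      using Z[of z] nZ[of z] that(3) by (cases "z \<in> Z") simp_all
  qed
  show ?thesis
    using assms(2-)
  proof (induction X A arbitrary: e Z rule: ex_scopes.induct)
    case (1 X x A)
    have "sat M (e(x := u)) A" if u: "u \<in> universe M" for u
    proof (rule "1.IH"[where Z = Z])
      show "z \<in> Z \<Longrightarrow> (e(x := u)) z = eval M (e(x := u)) (\<theta> z) \<and>
          vars_trm (\<theta> z) \<inter> set (bound_vars A) = {}" for z
        using "1.prems"(5)[of z] "1.prems"(9) by (auto simp: eval_fresh_upd)
      show "wf_trm S (\<theta> y) \<and> vars_trm (\<theta> y) \<inter> set (bound_vars A) \<subseteq> Y"
        if "(y, Y) \<in> set (ex_scopes (insert x X) A)" for y Y
        using "1.prems"(4)[of y Y] that by auto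
      show "range (e(x := u)) \<subseteq> universe M" using "1.prems"(8) u by auto
    qed (use "1.prems" in \<open>auto simp: prenex_def\<close>)
    then show ?case by simp
  next
    case (2 X y A)
    define u where "u = eval M e (\<theta> y)"
    have y: "wf_trm S (\<theta> y)" "vars_trm (\<theta> y) \<inter> set (bound_vars (Ex y A)) = {}"
      using "2.prems"(3) "2.prems"(4)[of y X] by auto
    have u: "u \<in> universe M"
      unfolding u_def by (rule eval_in_universe[OF assms(1) y(1) "2.prems"(8)])
    have "sat M (e(y := u)) A"
    proof (rule "2.IH"[where Z = "insert y Z"])
      show "(e(y := u)) z = eval M (e(y := u)) (\<theta> z) \<and> vars_trm (\<theta> z) \<inter> set (bound_vars A) = {}"
        if "z \<in> insert y Z" for z
        using "2.prems"(5)[of z] "2.prems"(9) that y(2) u_def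
        by (auto simp: eval_fresh_upd)
      show "wf_trm S (\<theta> z) \<and> vars_trm (\<theta> z) \<inter> set (bound_vars A) \<subseteq> Y"
        if "(z, Y) \<in> set (ex_scopes X A)" for z Y
        using "2.prems"(4)[of z Y] that by auto
      show "range (e(y := u)) \<subseteq> universe M" using "2.prems"(8) u by auto
    qed (use "2.prems" in \<open>auto simp: prenex_def\<close>)
    then show ?case using u by auto
  next
    case ("3_1" X p ts)
    show ?case
      by (rule quantifier_free[OF "3_1.prems"(7) _ _ "3_1.prems"(5,6)]) simp_all
  next
    case ("3_2" X p ts)
    show ?case
      by (rule quantifier_free[OF "3_2.prems"(7) _ _ "3_2.prems"(5,6)]) simp_all
  next
    case ("3_3" X A B)
    show ?case
      by (rule quantifier_free[OF "3_3.prems"(7) _ _ "3_3.prems"(5,6)]) simp_all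
  next
    case ("3_4" X A B)
    show ?case
      by (rule quantifier_free[OF "3_4.prems"(7) _ _ "3_4.prems"(5,6)]) simp_all
  qed
qed

lemma valid_of_herbrand_proof:
  fixes S :: "('f, 'p) signature"
  assumes "herbrand_proof S A A' ts"
  shows "valid TYPE('u) S A"
  unfolding valid_def
proof (intro allI impI)
  fix M :: "('f, 'p, 'u) interp" and e :: "nat \<Rightarrow> 'u"
  assume M: "is_interp S M \<and> range e \<subseteq> universe M"
  obtain E where E: "strong_or_expansion A E" "prenexification E A'"
    and w: "witnessing_substitution S A' ts"
    using assms unfolding herbrand_proof_def by blast
  let ?sc = "ex_scopes {} A'"
  let ?ys = "map fst ?sc"
  have len: "length ts = length ?sc" and d: "distinct (bound_vars A')"
    using w by (auto simp: witnessing_substitution_def alpha_normal_def)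
  have dys: "distinct ?ys"
    using d distinct_ex_scopes_vars by blast
  have theta: "subst_of ?ys ts (fst (?sc ! i)) = ts ! i" if "i < length ts" for i
    using that len map_of_zip_nth[of ?ys ts i] dys unfolding subst_of_def by simp
  have "sat M e A'"
  proof (rule sat_prenex_by_witnesses[where X = "{}" and Z = "{}" and \<theta> = "subst_of ?ys ts"])
    fix y Y assume "(y, Y) \<in> set ?sc"
    then obtain i where i: "i < length ?sc" "?sc ! i = (y, Y)" by (auto simp: in_set_conv_nth)
    then have "wf_trm S (ts ! i) \<and> vars_trm (ts ! i) \<inter> set (bound_vars A') \<subseteq> Y"
      using len w unfolding witnessing_substitution_def by (metis snd_conv)
    then show "wf_trm S (subst_of ?ys ts y) \<and>
        vars_trm (subst_of ?ys ts y) \<inter> set (bound_vars A') \<subseteq> Y"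
      using theta[of i] len i by simp
  next
    fix z assume "z \<notin> fst ` set ?sc"
    then show "subst_of ?ys ts z = Var z"
      unfolding subst_of_def by (auto split: option.split dest!: map_of_SomeD set_zip_leftD)
  qed (use M w d in \<open>auto simp: witnessing_substitution_def\<close>)
  moreover have "sat M e E \<longleftrightarrow> sat M e A'"
    using E(2) M sat_pull_quantifiers[of E A' M e]
    by (auto simp: prenexification_def is_interp_def)
  ultimately show "sat M e A" using sat_strong_or_expansion[OF E(1)] by blast
qed

section \<open>Congruence of rewriting\<close>

lemma rtranclp_in_context_map:
  assumes "(in_context R)\<^sup>*\<^sup>* A B"
    and "\<And>A B. in_context R A B \<Longrightarrow> in_context R (C A) (C B)"
  shows "(in_context R)\<^sup>*\<^sup>* (C A) (C B)"
  using assms(1) by induction (auto intro: rtranclp.rtrancl_into_rtrancl assms(2))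

lemma rewrite_All: "(in_context R)\<^sup>*\<^sup>* A B \<Longrightarrow> (in_context R)\<^sup>*\<^sup>* (All x A) (All x B)"
  by (rule rtranclp_in_context_map) (auto intro: in_context.intros)

lemma rewrite_Ex: "(in_context R)\<^sup>*\<^sup>* A B \<Longrightarrow> (in_context R)\<^sup>*\<^sup>* (Ex x A) (Ex x B)"
  by (rule rtranclp_in_context_map) (auto intro: in_context.intros)

lemma rewrite_And:
  assumes "(in_context R)\<^sup>*\<^sup>* A A'" "(in_context R)\<^sup>*\<^sup>* B B'"
  shows "(in_context R)\<^sup>*\<^sup>* (And A B) (And A' B')"
proof -
  have "(in_context R)\<^sup>*\<^sup>* (And A B) (And A' B)"
    by (rule rtranclp_in_context_map[OF assms(1)]) (rule in_context.AndL)
  also have "(in_context R)\<^sup>*\<^sup>* (And A' B) (And A' B')"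
    by (rule rtranclp_in_context_map[OF assms(2)]) (rule in_context.AndR)
  finally show ?thesis .
qed

lemma rewrite_Or:
  assumes "(in_context R)\<^sup>*\<^sup>* A A'" "(in_context R)\<^sup>*\<^sup>* B B'"
  shows "(in_context R)\<^sup>*\<^sup>* (Or A B) (Or A' B')"
proof -
  have "(in_context R)\<^sup>*\<^sup>* (Or A B) (Or A' B)"
    by (rule rtranclp_in_context_map[OF assms(1)]) (rule in_context.OrL)
  also have "(in_context R)\<^sup>*\<^sup>* (Or A' B) (Or A' B')"
    by (rule rtranclp_in_context_map[OF assms(2)]) (rule in_context.OrR)
  finally show ?thesis .
qed

fun big_or :: "(nat \<Rightarrow> ('f, 'p) fm) \<Rightarrow> nat \<Rightarrow> ('f, 'p) fm" where
  "big_or f 0 = f 0"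
| "big_or f (Suc n) = Or (big_or f n) (f (Suc n))"

lemma rewrite_big_or:
  "(\<And>i. i \<le> n \<Longrightarrow> (in_context R)\<^sup>*\<^sup>* (f i) (g i)) \<Longrightarrow> (in_context R)\<^sup>*\<^sup>* (big_or f n) (big_or g n)"
  by (induction n) (auto intro: rewrite_Or)

lemma subst_fm_big_or: "subst_fm \<sigma> (big_or f n) = big_or (\<lambda>i. subst_fm \<sigma> (f i)) n"
  by (induction n) auto

lemma prop_eval_big_or: "prop_eval v (big_or f n) \<longleftrightarrow> (\<exists>i\<le>n. prop_eval v (f i))"
  by (induction n) (auto simp: le_Suc_eq)


section \<open>The full expansion\<close>

text \<open>
  The copies keep their bound variables, so that plain duplication steps reach this formula.
\<close>

fun duplicate :: "nat \<Rightarrow> ('f, 'p) fm \<Rightarrow> ('f, 'p) fm" where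
  "duplicate K (Pos p ts) = Pos p ts"
| "duplicate K (Neg p ts) = Neg p ts"
| "duplicate K (And A B) = And (duplicate K A) (duplicate K B)"
| "duplicate K (Or A B) = Or (duplicate K A) (duplicate K B)"
| "duplicate K (All x A) = All x (duplicate K A)"
| "duplicate K (Ex x A) = big_or (\<lambda>_. Ex x (duplicate K A)) K"

lemma duplicate_reachable: "(in_context duplicate_ex)\<^sup>*\<^sup>* A (duplicate K A)"
proof (induction A)
  case (Ex x A)
  have "(in_context duplicate_ex)\<^sup>*\<^sup>* (Ex x A) (big_or (\<lambda>_. Ex x A) n)" for n
  proof (induction n)
    case (Suc n)
    have "(in_context duplicate_ex)\<^sup>*\<^sup>* (Ex x A) (Or (Ex x A) (Ex x A))"
      by (rule r_into_rtranclp) (intro in_context.here duplicate_ex.intros)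
    also have "(in_context duplicate_ex)\<^sup>*\<^sup>* \<dots> (big_or (\<lambda>_. Ex x A) (Suc n))"
      using rewrite_Or[OF Suc.IH rtranclp.rtrancl_refl] by simp
    finally show ?case .
  qed simp
  also have "(in_context duplicate_ex)\<^sup>*\<^sup>* (big_or (\<lambda>_. Ex x A) K) (big_or (\<lambda>_. Ex x (duplicate K A)) K)"
    by (intro rewrite_big_or rewrite_Ex Ex.IH)
  finally show ?case by simp
qed (auto intro: rewrite_And rewrite_Or rewrite_All)

text \<open>
  A node of the expansion is addressed by a path, the list of the branches taken to it, with the last
  one first. A quantifier is named after the path of its body. Since \<open>list_encode\<close> increases with the path,
  names increase towards the leaves, and the name of copy \<open>i\<close> of an existential exceeds \<open>i\<close>. Parity
  separates the two kinds of quantifiers, and all names lie above the bound \<open>m\<close> for the variables of the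
  original formula.
\<close>

definition all_name :: "nat \<Rightarrow> nat list \<Rightarrow> nat" where
  "all_name m p = m + 2 * list_encode p + 1"

definition ex_name :: "nat \<Rightarrow> nat list \<Rightarrow> nat" where
  "ex_name m p = m + 2 * list_encode p"

definition name_path :: "nat \<Rightarrow> nat \<Rightarrow> nat list" where
  "name_path m z = list_decode ((z - m) div 2)"

lemma name_path_simps [simp]: "name_path m (all_name m p) = p" "name_path m (ex_name m p) = p"
  by (auto simp: name_path_def all_name_def ex_name_def)

text \<open>
  The function \<open>\<rho>\<close> gives the new names of the variables whose quantifiers have been passed. With it as
  an argument, the recursive calls are on subformulae and not on renamed ones.
\<close>

fun expand :: "nat \<Rightarrow> nat \<Rightarrow> nat list \<Rightarrow> (nat \<Rightarrow> nat) \<Rightarrow> ('f, 'p) fm \<Rightarrow> ('f, 'p) fm" where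
  "expand m K p \<rho> (Pos q ts) = Pos q (map (subst_trm (\<lambda>x. Var (\<rho> x))) ts)"
| "expand m K p \<rho> (Neg q ts) = Neg q (map (subst_trm (\<lambda>x. Var (\<rho> x))) ts)"
| "expand m K p \<rho> (And A B) = And (expand m K (0 # p) \<rho> A) (expand m K (1 # p) \<rho> B)"
| "expand m K p \<rho> (Or A B) = Or (expand m K (0 # p) \<rho> A) (expand m K (1 # p) \<rho> B)"
| "expand m K p \<rho> (All x A) =
    All (all_name m (0 # p)) (expand m K (0 # p) (\<rho>(x := all_name m (0 # p))) A)"
| "expand m K p \<rho> (Ex x A) =
    big_or (\<lambda>i. Ex (ex_name m (i # p)) (expand m K (i # p) (\<rho>(x := ex_name m (i # p))) A)) K"

lemma list_encode_Cons_gt: "i < list_encode (i # p)" "list_encode p < list_encode (i # p)"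
  by (simp_all add: le_imp_less_Suc le_prod_encode_1 le_prod_encode_2)

lemma subst_trm_Var [simp]: "subst_trm Var t = t"
  by (induction t) (auto simp: map_idI)

lemma subst_fm_Var [simp]: "subst_fm Var A = A"
  by (induction A) (auto simp: map_idI fun_upd_idem)

lemma subst_trm_cong: "(\<And>x. x \<in> vars_trm t \<Longrightarrow> \<sigma> x = \<tau> x) \<Longrightarrow> subst_trm \<sigma> t = subst_trm \<tau> t"
  by (induction t) (simp_all, metis)

lemma subst_subst_trm: "subst_trm \<tau> (subst_trm \<sigma> t) = subst_trm (\<lambda>x. subst_trm \<tau> (\<sigma> x)) t"
  by (induction t) auto

lemma subst_fm_cong: "(\<And>x. x \<in> free_vars A \<Longrightarrow> \<sigma> x = \<tau> x) \<Longrightarrow> subst_fm \<sigma> A = subst_fm \<tau> A"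
proof (induction A arbitrary: \<sigma> \<tau>)
  case (And A B)
  then show ?case by (metis UnCI free_vars.simps(3) subst_fm.simps(3))
next
  case (Or A B)
  then show ?case by (metis UnCI free_vars.simps(4) subst_fm.simps(4))
next
  case (All x A)
  have "subst_fm (\<sigma>(x := Var x)) A = subst_fm (\<tau>(x := Var x)) A"
    by (rule All.IH) (use All.prems in auto)
  then show ?case by simp
next
  case (Ex x A)
  have "subst_fm (\<sigma>(x := Var x)) A = subst_fm (\<tau>(x := Var x)) A"
    by (rule Ex.IH) (use Ex.prems in auto)
  then show ?case by simp
qed (auto intro!: subst_trm_cong)

text \<open>
  The side condition is the same absence of capture as in \<open>sat_subst_fm\<close>.
\<close>

lemma subst_subst_fm:
  assumes "\<And>z b. z \<in> free_vars A \<Longrightarrow> b \<in> set (bound_vars A) \<Longrightarrow> z \<noteq> b \<Longrightarrow> b \<notin> vars_trm (\<sigma> z)"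
  shows "subst_fm \<tau> (subst_fm \<sigma> A) = subst_fm (\<lambda>z. subst_trm \<tau> (\<sigma> z)) A"
  using assms
proof (induction A arbitrary: \<sigma> \<tau>)
  case (All x A)
  have "subst_fm (\<tau>(x := Var x)) (subst_fm (\<sigma>(x := Var x)) A)
      = subst_fm (\<lambda>z. subst_trm (\<tau>(x := Var x)) ((\<sigma>(x := Var x)) z)) A"
    by (rule All.IH) (use All.prems in \<open>auto split: if_splits\<close>)
  also have "\<dots> = subst_fm ((\<lambda>z. subst_trm \<tau> (\<sigma> z))(x := Var x)) A"
    by (rule subst_fm_cong) (use All.prems in \<open>auto intro!: subst_trm_cong\<close>)
  finally show ?case by simp
next
  case (Ex x A)
  have "subst_fm (\<tau>(x := Var x)) (subst_fm (\<sigma>(x := Var x)) A)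
      = subst_fm (\<lambda>z. subst_trm (\<tau>(x := Var x)) ((\<sigma>(x := Var x)) z)) A"
    by (rule Ex.IH) (use Ex.prems in \<open>auto split: if_splits\<close>)
  also have "\<dots> = subst_fm ((\<lambda>z. subst_trm \<tau> (\<sigma> z))(x := Var x)) A"
    by (rule subst_fm_cong) (use Ex.prems in \<open>auto intro!: subst_trm_cong\<close>)
  finally show ?case by simp
qed (auto simp: subst_subst_trm)

lemma free_vars_subst_fm:
  "free_vars (subst_fm \<sigma> A) \<subseteq> (\<Union>z\<in>free_vars A. vars_trm (\<sigma> z))"
proof -
  have trm: "vars_trm (subst_trm \<sigma> t) = (\<Union>z\<in>vars_trm t. vars_trm (\<sigma> z))" for \<sigma> :: "nat \<Rightarrow> 'a trm" and t
    by (induction t) auto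
  show ?thesis
  proof (induction A arbitrary: \<sigma>)
    case (All x A)
    have "free_vars (subst_fm (\<sigma>(x := Var x)) A) \<subseteq> (\<Union>z\<in>free_vars A. vars_trm ((\<sigma>(x := Var x)) z))"
      by (rule All.IH)
    then show ?case by (fastforce split: if_splits)
  next
    case (Ex x A)
    have "free_vars (subst_fm (\<sigma>(x := Var x)) A) \<subseteq> (\<Union>z\<in>free_vars A. vars_trm ((\<sigma>(x := Var x)) z))"
      by (rule Ex.IH)
    then show ?case by (fastforce split: if_splits)
  qed (simp_all add: trm, blast+)
qed

definition all_vars :: "('f, 'p) fm \<Rightarrow> nat set" where
  "all_vars A = free_vars A \<union> set (bound_vars A)"

lemma vars_big_or:
  "set (bound_vars (big_or f n)) = (\<Union>i\<le>n. set (bound_vars (f i)))"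
  "free_vars (big_or f n) = (\<Union>i\<le>n. free_vars (f i))"
  by (induction n) (auto simp: le_Suc_eq)

lemma vars_duplicate:
  "free_vars (duplicate K A) = free_vars A" "set (bound_vars (duplicate K A)) = set (bound_vars A)"
  by (induction A) (auto simp: vars_big_or)

text \<open>
  At a node with path \<open>p\<close>, only names of quantifiers at \<open>p\<close> or above it have been assigned; the
  bound \<open>m + 2 * list_encode p + 2\<close> exceeds all of these and no name of a quantifier below.
\<close>

definition fresh_renaming :: "nat \<Rightarrow> nat list \<Rightarrow> (nat \<Rightarrow> nat) \<Rightarrow> bool" where
  "fresh_renaming m p \<rho> \<longleftrightarrow>
    (\<forall>z<m. (\<rho> z = z \<or> m \<le> \<rho> z) \<and> \<rho> z < m + 2 * list_encode p + 2)"

lemma fresh_renaming_Cons: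
  assumes "fresh_renaming m p \<rho>"
  shows "fresh_renaming m (i # p) \<rho>"
proof -
  have "m + 2 * list_encode p + 2 < m + 2 * list_encode (i # p) + 2"
    using list_encode_Cons_gt(2)[of p i] by linarith
  with assms show ?thesis unfolding fresh_renaming_def using less_trans by blast
qed

lemma fresh_renaming_upd:
  assumes "fresh_renaming m p \<rho>" "y = all_name m (i # p) \<or> y = ex_name m (i # p)"
  shows "fresh_renaming m (i # p) (\<rho>(x := y))"
  using fresh_renaming_Cons[OF assms(1), of i] assms(2)
  by (auto simp: fresh_renaming_def all_name_def ex_name_def)

text \<open>
  One admissible renaming of an outermost quantifier \<open>x\<close> to its final name \<open>y\<close>. Working from the
  outside in, the body still has its old bound variables, all below \<open>m\<close>, so the large name \<open>y\<close> is fresh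
  for it, even if the quantifiers of \<open>A\<close> shadow one another or bind variables that are free elsewhere.
\<close>

lemma rename_step:
  fixes A :: "('f, 'p) fm"
  assumes fr: "fresh_renaming m p \<rho>" and vars: "all_vars A \<subseteq> {..<m} " "x < m"
    and y: "y = all_name m (i # p) \<or> y = ex_name m (i # p)"
  defines "B \<equiv> subst_fm ((\<lambda>z. Var (\<rho> z))(x := Var x)) A"
  shows "y \<notin> free_vars B \<union> set (bound_vars B)"
    and "subst_fm (Var(x := Var y)) B = subst_fm (\<lambda>z. Var ((\<rho>(x := y)) z)) A"
proof -
  have y_gt: "m + 2 * list_encode p + 2 \<le> y"
    using y list_encode_Cons_gt(2)[of p i] unfolding all_name_def ex_name_def by linarith
  have ne: "\<rho> z \<noteq> b" if "z < m" "b < m" "z \<noteq> b" for z b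
    using fr that unfolding fresh_renaming_def by (metis leD)
  have lt: "\<rho> z < y" if "z < m" for z
    using fr that y_gt unfolding fresh_renaming_def by (meson less_le_trans)
  have fv: "z < m" if "z \<in> free_vars A" for z using vars that unfolding all_vars_def by auto
  have bv: "z < m" if "z \<in> set (bound_vars A)" for z using vars that unfolding all_vars_def by auto
  have "y \<notin> free_vars B"
  proof
    assume "y \<in> free_vars B"
    then have "y \<in> (\<Union>z\<in>free_vars A. vars_trm (((\<lambda>z. Var (\<rho> z))(x := Var x :: 'f trm)) z))"
      using free_vars_subst_fm unfolding B_def by (rule subsetD[rotated])
    then obtain z where "z \<in> free_vars A" "y \<in> vars_trm (((\<lambda>z. Var (\<rho> z))(x := Var x :: 'f trm)) z)"
      by (rule UN_E)
    then show False using lt[OF fv[of z]] vars(2) y_gt by (cases "z = x") simp_all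
  qed
  moreover have "y \<notin> set (bound_vars B)"
    using bv[of y] y_gt unfolding B_def by auto
  ultimately show "y \<notin> free_vars B \<union> set (bound_vars B)" by blast
  have "subst_fm (Var(x := Var y)) B =
      subst_fm (\<lambda>z. subst_trm (Var(x := Var y)) (((\<lambda>z. Var (\<rho> z))(x := Var x)) z)) A"
    unfolding B_def
  proof (rule subst_subst_fm)
    fix z b assume "z \<in> free_vars A" "b \<in> set (bound_vars A)" "z \<noteq> b"
    then show "b \<notin> vars_trm (((\<lambda>z. Var (\<rho> z))(x := Var x)) z)"
      using ne[OF fv bv, of z b] by (cases "z = x") auto
  qed
  also have "\<dots> = subst_fm (\<lambda>z. Var ((\<rho>(x := y)) z)) A"
  proof (rule subst_fm_cong)
    fix z assume "z \<in> free_vars A"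
    then show "subst_trm (Var(x := Var y)) (((\<lambda>z. Var (\<rho> z))(x := Var x)) z) = Var ((\<rho>(x := y)) z)"
      using ne[OF fv vars(2), of z] by (cases "z = x") simp_all
  qed
  finally show "subst_fm (Var(x := Var y)) B = subst_fm (\<lambda>z. Var ((\<rho>(x := y)) z)) A" .
qed

lemma expand_renames_duplicate:
  assumes "all_vars A \<subseteq> {..<m}" and "fresh_renaming m p \<rho>"
  shows "(in_context rename_bound)\<^sup>*\<^sup>* (subst_fm (\<lambda>z. Var (\<rho> z)) (duplicate K A)) (expand m K p \<rho> A)"
  using assms
proof (induction A arbitrary: p \<rho>)
  case (And A B)
  then show ?case by (simp add: all_vars_def rewrite_And fresh_renaming_Cons)
next
  case (Or A B)
  then show ?case by (simp add: all_vars_def rewrite_Or fresh_renaming_Cons)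
next
  case (All x A)
  let ?y = "all_name m (0 # p)"
  let ?B = "subst_fm ((\<lambda>z. Var (\<rho> z))(x := Var x)) (duplicate K A)"
  have x: "x < m" and A: "all_vars A \<subseteq> {..<m}" "all_vars (duplicate K A) \<subseteq> {..<m}"
    using All.prems(1) by (auto simp: all_vars_def vars_duplicate)
  note step = rename_step[OF All.prems(2) A(2) x disjI1[OF refl], of 0]
  have "in_context rename_bound (All x ?B) (All ?y (subst_fm (\<lambda>z. Var ((\<rho>(x := ?y)) z)) (duplicate K A)))"
    using in_context.here[of rename_bound, OF rename_bound.All[where x = x, OF step(1)]] unfolding step(2) .
  moreover have "(in_context rename_bound)\<^sup>*\<^sup>*
      (All ?y (subst_fm (\<lambda>z. Var ((\<rho>(x := ?y)) z)) (duplicate K A))) (expand m K p \<rho> (All x A))"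
    using All.IH[OF A(1) fresh_renaming_upd[OF All.prems(2) disjI1[OF refl]]]
    unfolding expand.simps by (rule rewrite_All)
  ultimately show ?case by (simp add: converse_rtranclp_into_rtranclp)
next
  case (Ex x A)
  have x: "x < m" and A: "all_vars A \<subseteq> {..<m}" "all_vars (duplicate K A) \<subseteq> {..<m}"
    using Ex.prems(1) by (auto simp: all_vars_def vars_duplicate)
  have "(in_context rename_bound)\<^sup>*\<^sup>* (Ex x (subst_fm ((\<lambda>z. Var (\<rho> z))(x := Var x)) (duplicate K A)))
     (Ex (ex_name m (i # p)) (expand m K (i # p) (\<rho>(x := ex_name m (i # p))) A))" for i
  proof -
    let ?y = "ex_name m (i # p)"
    let ?B = "subst_fm ((\<lambda>z. Var (\<rho> z))(x := Var x)) (duplicate K A)"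
    note step = rename_step[OF Ex.prems(2) A(2) x disjI2[OF refl], of i]
    have "in_context rename_bound (Ex x ?B) (Ex ?y (subst_fm (\<lambda>z. Var ((\<rho>(x := ?y)) z)) (duplicate K A)))"
      using in_context.here[of rename_bound, OF rename_bound.Ex[where x = x, OF step(1)]] unfolding step(2) .
    moreover have "(in_context rename_bound)\<^sup>*\<^sup>*
        (Ex ?y (subst_fm (\<lambda>z. Var ((\<rho>(x := ?y)) z)) (duplicate K A)))
        (Ex ?y (expand m K (i # p) (\<rho>(x := ?y)) A))"
      using Ex.IH[OF A(1) fresh_renaming_upd[OF Ex.prems(2) disjI2[OF refl]]]
      by (rule rewrite_Ex)
    ultimately show ?thesis by (simp add: converse_rtranclp_into_rtranclp)
  qed
  then show ?case by (simp add: subst_fm_big_or rewrite_big_or)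
qed simp_all

lemma strong_or_expansion_expand:
  assumes "all_vars A \<subseteq> {..<m}"
  shows "strong_or_expansion A (expand m K [] id A)"
proof -
  have "(in_context rename_bound)\<^sup>*\<^sup>* (duplicate K A) (expand m K [] id A)"
    using expand_renames_duplicate[OF assms, of "[]" id K] by (simp add: fresh_renaming_def)
  then have "alpha_equiv (duplicate K A) (expand m K [] id A)"
    unfolding alpha_equiv_def using rtranlcp_le_equivclp by (rule predicate2D[rotated])
  then show ?thesis
    unfolding strong_or_expansion_def using duplicate_reachable by blast
qed


section \<open>Prenexification\<close>

fun quants :: "('f, 'p) fm \<Rightarrow> (bool \<times> nat) list" where
  "quants (And A B) = quants A @ quants B"
| "quants (Or A B) = quants A @ quants B"
| "quants (All x A) = (True, x) # quants A"
| "quants (Ex x A) = (False, x) # quants A"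
| "quants A = []"

fun strip :: "('f, 'p) fm \<Rightarrow> ('f, 'p) fm" where
  "strip (And A B) = And (strip A) (strip B)"
| "strip (Or A B) = Or (strip A) (strip B)"
| "strip (All x A) = strip A"
| "strip (Ex x A) = strip A"
| "strip A = A"

fun quantify :: "(bool \<times> nat) list \<Rightarrow> ('f, 'p) fm \<Rightarrow> ('f, 'p) fm" where
  "quantify [] A = A"
| "quantify ((q, x) # Q) A = (if q then All else Ex) x (quantify Q A)"

text \<open>
  Pulling quantifiers in the order of their names never requires one to overtake a quantifier of whose
  body it is a part, provided that names increase inwards.
\<close>

fun increasing :: "('f, 'p) fm \<Rightarrow> bool" where
  "increasing (And A B) \<longleftrightarrow> increasing A \<and> increasing B"
| "increasing (Or A B) \<longleftrightarrow> increasing A \<and> increasing B"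
| "increasing (All x A) \<longleftrightarrow> (\<forall>y\<in>set (bound_vars A). x < y) \<and> increasing A"
| "increasing (Ex x A) \<longleftrightarrow> (\<forall>y\<in>set (bound_vars A). x < y) \<and> increasing A"
| "increasing A \<longleftrightarrow> True"

lemma bound_vars_quants: "bound_vars A = map snd (quants A)"
  by (induction A) auto

lemma bound_vars_strip [simp]: "bound_vars (strip A) = []"
  by (induction A) auto

lemma matrix_quantifier_free: "bound_vars A = [] \<Longrightarrow> matrix A = A"
  by (cases A) auto

lemma quantify_simps:
  assumes "bound_vars A = []"
  shows "bound_vars (quantify Q A) = map snd Q" "matrix (quantify Q A) = A"
    "free_vars (quantify Q A) = free_vars A - snd ` set Q"
  using assms by (induction Q A rule: quantify.induct) (auto simp: matrix_quantifier_free)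

fun merge :: "(bool \<times> nat) list \<Rightarrow> (bool \<times> nat) list \<Rightarrow> (bool \<times> nat) list" where
  "merge [] R = R"
| "merge Q [] = Q"
| "merge (a # Q) (b # R) = (if snd a < snd b then a # merge Q (b # R) else b # merge (a # Q) R)"

lemma set_merge: "set (merge Q R) = set Q \<union> set R"
  by (induction Q R rule: merge.induct) auto

lemma sorted_merge:
  assumes "sorted_wrt (<) (map snd Q)" "sorted_wrt (<) (map snd R)" "snd ` set Q \<inter> snd ` set R = {}"
  shows "sorted_wrt (<) (map snd (merge Q R))"
  using assms
proof (induction Q R rule: merge.induct)
  case (3 a Q b R)
  show ?case
  proof (cases "snd a < snd b")
    case True
    with 3 show ?thesis by (auto simp: set_merge dest: less_trans)
  next
    case False
    with "3.prems"(3) have "snd b < snd a" by auto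
    with 3 False show ?thesis by (auto simp: set_merge dest: less_trans)
  qed
qed auto

lemma pull_left:
  assumes "C = And \<or> C = Or"
  shows "in_context pull_quantifier (C (quantify (a # Q) A) B) (quantify [a] (C (quantify Q A) B))"
  using assms by (cases a) (auto intro!: in_context.here pull_quantifier.intros)

lemma pull_right:
  assumes "C = And \<or> C = Or"
  shows "in_context pull_quantifier (C A (quantify (a # Q) B)) (quantify [a] (C A (quantify Q B)))"
  using assms by (cases a) (auto intro!: in_context.here pull_quantifier.intros)

lemma quantify_Cons: "quantify (a # Q) A = quantify [a] (quantify Q A)"
  by (cases a) simp

lemma rewrite_quantify1:
  "(in_context R)\<^sup>*\<^sup>* A B \<Longrightarrow> (in_context R)\<^sup>*\<^sup>* (quantify [a] A) (quantify [a] B)"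
  by (cases a) (auto intro: rewrite_All rewrite_Ex)

text \<open>
  Two prefixes can be interleaved arbitrarily by pulling from the left or from the right, so in
  particular in the order of the names.
\<close>

lemma pull_merge:
  assumes C: "C = And \<or> C = Or"
  shows "(in_context pull_quantifier)\<^sup>*\<^sup>* (C (quantify Q A) (quantify R B)) (quantify (merge Q R) (C A B))"
proof (induction Q R rule: merge.induct)
  case (1 R)
  show ?case
  proof (induction R)
    case (Cons b R)
    have "in_context pull_quantifier (C (quantify [] A) (quantify (b # R) B))
        (quantify [b] (C (quantify [] A) (quantify R B)))"
      by (rule pull_right[OF C])
    also have "(in_context pull_quantifier)\<^sup>*\<^sup>* \<dots> (quantify [b] (quantify (merge [] R) (C A B)))"
      by (rule rewrite_quantify1[OF Cons.IH])
    finally show ?case by (simp add: quantify_Cons[of b R])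
  qed simp
next
  case (2 a Q)
  show ?case
  proof (induction "a # Q" arbitrary: a Q)
    case (Cons a Q)
    have "in_context pull_quantifier (C (quantify (a # Q) A) (quantify [] B))
        (quantify [a] (C (quantify Q A) (quantify [] B)))"
      by (rule pull_left[OF C])
    also have "(in_context pull_quantifier)\<^sup>*\<^sup>* \<dots> (quantify [a] (quantify Q (C A B)))"
      by (rule rewrite_quantify1) (use Cons.hyps in \<open>cases Q; simp\<close>)
    finally show ?case by (simp add: quantify_Cons[of a Q])
  qed
next
  case (3 a Q b R)
  show ?case
  proof (cases "snd a < snd b")
    case True
    have "in_context pull_quantifier (C (quantify (a # Q) A) (quantify (b # R) B))
        (quantify [a] (C (quantify Q A) (quantify (b # R) B)))"
      by (rule pull_left[OF C])
    also have "(in_context pull_quantifier)\<^sup>*\<^sup>* \<dots> (quantify [a] (quantify (merge Q (b # R)) (C A B)))"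
      by (rule rewrite_quantify1[OF "3.IH"(1)[OF True]])
    finally show ?thesis using True by (simp add: quantify_Cons[of a "merge Q (b # R)"])
  next
    case False
    have "in_context pull_quantifier (C (quantify (a # Q) A) (quantify (b # R) B))
        (quantify [b] (C (quantify (a # Q) A) (quantify R B)))"
      by (rule pull_right[OF C])
    also have "(in_context pull_quantifier)\<^sup>*\<^sup>* \<dots> (quantify [b] (quantify (merge (a # Q) R) (C A B)))"
      by (rule rewrite_quantify1[OF "3.IH"(2)[OF False]])
    finally show ?thesis using False by (simp add: quantify_Cons[of b "merge (a # Q) R"])
  qed
qed

definition sorted_prefix :: "(bool \<times> nat) list \<Rightarrow> ('f, 'p) fm \<Rightarrow> bool" where
  "sorted_prefix Q A \<longleftrightarrow> sorted_wrt (<) (map snd Q) \<and> set Q = set (quants A) \<and>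
    (in_context pull_quantifier)\<^sup>*\<^sup>* A (quantify Q (strip A))"

lemma sorted_prefix_merge:
  assumes "C = And \<or> C = Or" "sorted_prefix Q A" "sorted_prefix R B"
    and "set (bound_vars A) \<inter> set (bound_vars B) = {}"
  shows "sorted_prefix (merge Q R) (C A B)"
proof -
  have "(in_context pull_quantifier)\<^sup>*\<^sup>* (C A B) (C (quantify Q (strip A)) (quantify R (strip B)))"
    using assms(1-3) unfolding sorted_prefix_def by (auto intro: rewrite_And rewrite_Or)
  also have "(in_context pull_quantifier)\<^sup>*\<^sup>* \<dots> (quantify (merge Q R) (C (strip A) (strip B)))"
    by (rule pull_merge[OF assms(1)])
  finally show ?thesis
    using assms unfolding sorted_prefix_def bound_vars_quants
    by (auto simp: set_merge intro!: sorted_merge)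
qed

lemma sorted_prefix_exists:
  assumes "increasing A" "distinct (bound_vars A)"
  shows "\<exists>Q. sorted_prefix Q A"
  using assms
proof (induction A)
  case (Pos p ts)
  show ?case by (rule exI[of _ "[]"]) (simp add: sorted_prefix_def)
next
  case (Neg p ts)
  show ?case by (rule exI[of _ "[]"]) (simp add: sorted_prefix_def)
next
  case (And A B)
  then obtain Q R where "sorted_prefix Q A" "sorted_prefix R B" by auto
  then show ?case using sorted_prefix_merge[of And Q A R B] And.prems(2) by auto
next
  case (Or A B)
  then obtain Q R where "sorted_prefix Q A" "sorted_prefix R B" by auto
  then show ?case using sorted_prefix_merge[of Or Q A R B] Or.prems(2) by auto
next
  case (All x A)
  then obtain Q where "sorted_prefix Q A" by auto
  then have "sorted_prefix ((True, x) # Q) (All x A)"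
    using All.prems(1) by (auto simp: sorted_prefix_def bound_vars_quants intro: rewrite_All)
  then show ?case ..
next
  case (Ex x A)
  then obtain Q where "sorted_prefix Q A" by auto
  then have "sorted_prefix ((False, x) # Q) (Ex x A)"
    using Ex.prems(1) by (auto simp: sorted_prefix_def bound_vars_quants intro: rewrite_Ex)
  then show ?case ..
qed

text \<open>
  In a sorted prefix, the universal variables to the left of \<open>y\<close> are those below \<open>y\<close>.
\<close>

lemma ex_scopes_quantify:
  assumes "bound_vars A = []"
  shows "map fst (ex_scopes X (quantify Q A)) = map snd (filter (\<lambda>a. \<not> fst a) Q)"
    and "sorted_wrt (<) (map snd Q) \<Longrightarrow> (y, Y) \<in> set (ex_scopes X (quantify Q A)) \<Longrightarrow>
      {x. (True, x) \<in> set Q \<and> x < y} \<subseteq> Y"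
proof -
  have nil: "ex_scopes X A = []" for X using assms by (cases A) auto
  show "map fst (ex_scopes X (quantify Q A)) = map snd (filter (\<lambda>a. \<not> fst a) Q)"
  proof (induction Q arbitrary: X)
    case (Cons a Q)
    then show ?case by (cases a) auto
  qed (simp add: nil)
  have "X \<union> {x. (True, x) \<in> set Q \<and> x < y} \<subseteq> Y"
    if "sorted_wrt (<) (map snd Q)" "(y, Y) \<in> set (ex_scopes X (quantify Q A))"
    using that
  proof (induction Q arbitrary: X)
    case (Cons a Q)
    then show ?case by (cases a) (fastforce split: if_splits)
  qed (simp add: nil)
  then show "sorted_wrt (<) (map snd Q) \<Longrightarrow> (y, Y) \<in> set (ex_scopes X (quantify Q A)) \<Longrightarrow>
      {x. (True, x) \<in> set Q \<and> x < y} \<subseteq> Y" by blast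
qed


section \<open>Names in the full expansion\<close>

lemma quants_big_or: "set (quants (big_or f n)) = (\<Union>i\<le>n. set (quants (f i)))"
  by (induction n) (auto simp: le_Suc_eq)

lemma increasing_big_or: "increasing (big_or f n) \<longleftrightarrow> (\<forall>i\<le>n. increasing (f i))"
  by (induction n) (auto simp: le_Suc_eq)

lemma distinct_bound_vars_big_or:
  assumes "\<And>i. i \<le> n \<Longrightarrow> distinct (bound_vars (f i))"
    and "\<And>i j. i \<le> n \<Longrightarrow> j \<le> n \<Longrightarrow> i \<noteq> j \<Longrightarrow> set (bound_vars (f i)) \<inter> set (bound_vars (f j)) = {}"
  shows "distinct (bound_vars (big_or f n))"
  using assms
proof (induction n)
  case (Suc n)
  have "set (bound_vars (f i)) \<inter> set (bound_vars (f (Suc n))) = {}" if "i \<le> n" for i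
    using Suc.prems(2)[of i "Suc n"] that by simp
  then have "set (bound_vars (big_or f n)) \<inter> set (bound_vars (f (Suc n))) = {}"
    unfolding vars_big_or by blast
  moreover have "distinct (bound_vars (big_or f n))"
    by (rule Suc.IH) (use Suc.prems in auto)
  ultimately show ?case using Suc.prems(1)[of "Suc n"] by simp
qed simp

text \<open>
  Paths grow at the front, so the nodes properly below \<open>p\<close> are those with \<open>p\<close> as a proper suffix.
\<close>

definition below :: "nat list \<Rightarrow> nat list \<Rightarrow> bool" where
  "below p q \<longleftrightarrow> (\<exists>r. r \<noteq> [] \<and> q = r @ p)"

lemma below_child: "below p (i # p)"
  unfolding below_def by (metis append_Cons append_Nil list.distinct(1))

lemma below_trans_child: "below (i # p) q \<Longrightarrow> below p q"
  unfolding below_def by auto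

lemma below_children_disjoint:
  assumes "below (i # p) q \<or> q = i # p" "below (j # p) q \<or> q = j # p"
  shows "i = j"
proof -
  obtain r s where "q = r @ [i] @ p" "q = s @ [j] @ p"
    using assms unfolding below_def by (metis append_Cons append_Nil append_assoc)
  then show ?thesis by simp
qed

lemma below_irrefl: "\<not> below p p"
  unfolding below_def by auto

lemma list_encode_below: "below p q \<Longrightarrow> list_encode p < list_encode q"
proof -
  have "list_encode p \<le> list_encode (r @ p)" for r
    by (induction r) (auto intro: le_SucI order_trans[OF _ le_prod_encode_2])
  then show "below p q \<Longrightarrow> list_encode p < list_encode q"
    unfolding below_def using list_encode_Cons_gt(2)
    by (metis append_Cons le_less_trans neq_Nil_conv)
qed

lemma quants_expand:
  "(q, z) \<in> set (quants (expand m K p \<rho> A)) \<Longrightarrow>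
    \<exists>r. below p r \<and> z = (if q then all_name m r else ex_name m r)"
proof (induction A arbitrary: p \<rho>)
  case (And A B)
  then show ?case using below_trans_child by fastforce
next
  case (Or A B)
  then show ?case using below_trans_child by fastforce
next
  case (All x A)
  then show ?case using below_trans_child below_child by fastforce
next
  case (Ex x A)
  then show ?case using below_trans_child below_child by (fastforce simp: quants_big_or)
qed auto

lemma bound_vars_expand:
  assumes "z \<in> set (bound_vars (expand m K p \<rho> A))"
  shows "below p (name_path m z)" "m \<le> z" "m + 2 * list_encode (name_path m z) \<le> z"
proof -
  obtain q where q: "(q, z) \<in> set (quants (expand m K p \<rho> A))"
    using assms unfolding bound_vars_quants by auto
  then obtain r where r: "below p r" "z = (if q then all_name m r else ex_name m r)"
    using quants_expand by blast
  then have path: "name_path m z = r" by simp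
  then show "below p (name_path m z)" using r(1) by simp
  show "m \<le> z" "m + 2 * list_encode (name_path m z) \<le> z"
    unfolding path by (simp_all add: r(2) all_name_def ex_name_def)
qed

lemma increasing_expand: "increasing (expand m K p \<rho> A)"
proof (induction A arbitrary: p \<rho>)
  case (All x A)
  have "all_name m (0 # p) < z" if "z \<in> set (bound_vars (expand m K (0 # p) \<rho>' A))" for z \<rho>'
    using list_encode_below[OF bound_vars_expand(1)[OF that]] bound_vars_expand(3)[OF that]
    unfolding all_name_def by linarith
  with All show ?case by simp
next
  case (Ex x A)
  have "ex_name m (i # p) < z" if "z \<in> set (bound_vars (expand m K (i # p) \<rho>' A))" for i z \<rho>'
    using list_encode_below[OF bound_vars_expand(1)[OF that]] bound_vars_expand(3)[OF that]
    unfolding ex_name_def by linarith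
  with Ex show ?case by (simp add: increasing_big_or)
qed auto

text \<open>
  Different quantifiers have bodies with different paths: siblings differ in the branch number, which
  stays in the paths of all nodes below them, and a node never shares its path with one below it.
\<close>

lemma distinct_expand: "distinct (bound_vars (expand m K p \<rho> A))"
proof (induction A arbitrary: p \<rho>)
  case (And A B)
  have "set (bound_vars (expand m K (0 # p) \<rho> A)) \<inter> set (bound_vars (expand m K (1 # p) \<rho> B)) = {}"
    using bound_vars_expand(1) below_children_disjoint by (metis disjoint_iff zero_neq_one)
  with And show ?case by simp
next
  case (Or A B)
  have "set (bound_vars (expand m K (0 # p) \<rho> A)) \<inter> set (bound_vars (expand m K (1 # p) \<rho> B)) = {}"
    using bound_vars_expand(1) below_children_disjoint by (metis disjoint_iff zero_neq_one)
  with Or show ?case by simp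
next
  case (All x A)
  have "all_name m (0 # p) \<notin> set (bound_vars (expand m K (0 # p) \<rho>' A))" for \<rho>'
    using bound_vars_expand(1) below_irrefl by (metis name_path_simps(1))
  with All show ?case by simp
next
  case (Ex x A)
  let ?f = "\<lambda>i. Ex (ex_name m (i # p)) (expand m K (i # p) (\<rho>(x := ex_name m (i # p))) A)"
  have paths: "below (i # p) (name_path m z) \<or> name_path m z = i # p"
    if "z \<in> set (bound_vars (?f i))" for i z
    using that bound_vars_expand(1) by auto
  have "ex_name m (i # p) \<notin> set (bound_vars (expand m K (i # p) \<rho>' A))" for i \<rho>'
    using bound_vars_expand(1) below_irrefl by (metis name_path_simps(2))
  with Ex have "distinct (bound_vars (?f i))" for i by simp
  moreover have "set (bound_vars (?f i)) \<inter> set (bound_vars (?f j)) = {}" if "i \<noteq> j" for i j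
    using paths below_children_disjoint that by (meson disjoint_iff)
  ultimately have "distinct (bound_vars (big_or ?f K))"
    by (intro distinct_bound_vars_big_or)
  then show ?case by simp
qed auto

lemma vars_subst_trm_Var: "vars_trm (subst_trm (\<lambda>x. Var (\<rho> x)) t) = \<rho> ` vars_trm t"
  by (induction t) auto

lemma free_vars_expand: "free_vars (expand m K p \<rho> A) \<subseteq> \<rho> ` free_vars A"
proof (induction A arbitrary: p \<rho>)
  case (And A B)
  then show ?case by (simp add: image_Un) blast
next
  case (Or A B)
  then show ?case by (simp add: image_Un) blast
next
  case (All x A)
  then show ?case by fastforce
next
  case (Ex x A)
  then show ?case by (fastforce simp: vars_big_or)
qed (auto simp: vars_subst_trm_Var)

lemma free_vars_strip: "free_vars (strip A) \<subseteq> free_vars A \<union> set (bound_vars A)"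
  by (induction A) auto


section \<open>Witnesses and instances of the full expansion\<close>

text \<open>
  This also covers numbers that are not used as names in a given expansion. A single criterion, independent of
  the expansion, is needed to say in advance which variables the witnesses may contain.
\<close>

definition is_ex_name :: "nat \<Rightarrow> nat \<Rightarrow> bool" where
  "is_ex_name m z \<longleftrightarrow> m \<le> z \<and> even (z - m)"

text \<open>
  The head of the path of an existential name is the number of the copy, which selects the witness.
\<close>

definition witness :: "nat \<Rightarrow> (nat \<Rightarrow> 'f trm) \<Rightarrow> nat \<Rightarrow> 'f trm" where
  "witness m T z = (if is_ex_name m z then T (hd (name_path m z)) else Var z)"

lemma is_ex_name_simps [simp]: "is_ex_name m (ex_name m p)" "\<not> is_ex_name m (all_name m p)"
  by (auto simp: is_ex_name_def ex_name_def all_name_def)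

lemma witness_simps [simp]:
  "witness m T (ex_name m (i # p)) = T i" "witness m T (all_name m p) = Var (all_name m p)"
  by (auto simp: witness_def)

text \<open>
  The truth value of the instantiated matrix, computed along the original formula without building the
  expansion. Here \<open>\<sigma>\<close> maps a bound variable of the original formula directly to the term that replaces it
  at the node \<open>p\<close>.
\<close>

fun holds :: "nat \<Rightarrow> (nat \<Rightarrow> 'f trm) \<Rightarrow> ('p \<Rightarrow> 'f trm list \<Rightarrow> bool) \<Rightarrow> nat \<Rightarrow>
    nat list \<Rightarrow> (nat \<Rightarrow> 'f trm) \<Rightarrow> ('f, 'p) fm \<Rightarrow> bool" where
  "holds m T v K p \<sigma> (Pos q ts) \<longleftrightarrow> v q (map (subst_trm \<sigma>) ts)"
| "holds m T v K p \<sigma> (Neg q ts) \<longleftrightarrow> \<not> v q (map (subst_trm \<sigma>) ts)"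
| "holds m T v K p \<sigma> (And A B) \<longleftrightarrow> holds m T v K (0 # p) \<sigma> A \<and> holds m T v K (1 # p) \<sigma> B"
| "holds m T v K p \<sigma> (Or A B) \<longleftrightarrow> holds m T v K (0 # p) \<sigma> A \<or> holds m T v K (1 # p) \<sigma> B"
| "holds m T v K p \<sigma> (All x A) \<longleftrightarrow>
    holds m T v K (0 # p) (\<sigma>(x := Var (all_name m (0 # p)))) A"
| "holds m T v K p \<sigma> (Ex x A) \<longleftrightarrow> (\<exists>i\<le>K. holds m T v K (i # p) (\<sigma>(x := T i)) A)"

lemma strip_big_or: "strip (big_or f n) = big_or (\<lambda>i. strip (f i)) n"
  by (induction n) auto

lemma prop_eval_strip_expand:
  "prop_eval v (subst_fm (witness m T) (strip (expand m K p \<rho> A)))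
    \<longleftrightarrow> holds m T v K p (\<lambda>x. witness m T (\<rho> x)) A"
proof (induction A arbitrary: p \<rho>)
  case (All x A)
  have "(\<lambda>z. witness m T ((\<rho>(x := all_name m (0 # p))) z))
      = (\<lambda>z. witness m T (\<rho> z))(x := Var (all_name m (0 # p)))"
    by auto
  with All show ?case by simp
next
  case (Ex x A)
  have "(\<lambda>z. witness m T ((\<rho>(x := ex_name m (i # p))) z)) = (\<lambda>z. witness m T (\<rho> z))(x := T i)" for i
    by auto
  with Ex show ?case by (simp add: strip_big_or subst_fm_big_or prop_eval_big_or)
qed (simp_all add: subst_subst_trm comp_def)

lemma bound_vars_expand_kind:
  assumes "(q, z) \<in> set (quants (expand m K p \<rho> A))"
  shows "q \<longleftrightarrow> \<not> is_ex_name m z"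
proof -
  obtain r where "z = (if q then all_name m r else ex_name m r)"
    using quants_expand[OF assms] by blast
  then show ?thesis by (cases q) simp_all
qed

text \<open>
  Here the properties of the names pay off. If \<open>y\<close> is copy number \<open>j\<close> of an existential, the variables of
  \<open>T j\<close> are at most \<open>j < y\<close> and no existential names; those that are bound at all are hence universal and
  smaller than \<open>y\<close>, and in the sorted prefix this means to the left of \<open>y\<close>.
\<close>

lemma herbrand_proof_of_holds:
  fixes S :: "('f, 'p) signature"
  assumes vars: "all_vars A \<subseteq> {..<m}"
    and wf: "\<And>i. wf_trm S (T i)"
    and T: "\<And>i z. z \<in> vars_trm (T i) \<Longrightarrow> z \<le> i \<and> \<not> is_ex_name m z"
    and holds: "\<And>v. holds m T v K [] (witness m T) A"
  shows "\<exists>A' ts. herbrand_proof S A A' ts"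
proof -
  \<comment> \<open>The initial renaming is the identity, as the free variables of \<open>A\<close> keep their names.\<close>
  define E where "E = expand m K [] id A"
  have distinct: "distinct (bound_vars E)"
    unfolding E_def by (rule distinct_expand)
  obtain Q where Q: "sorted_wrt (<) (map snd Q)" "set Q = set (quants E)"
    "(in_context pull_quantifier)\<^sup>*\<^sup>* E (quantify Q (strip E))"
    using sorted_prefix_exists[OF _ distinct] increasing_expand unfolding E_def sorted_prefix_def
    by blast
  define A' where "A' = quantify Q (strip E)"
  define ys where "ys = map fst (ex_scopes {} A')"
  define ts where "ts = map (witness m T) ys"
  have A': "bound_vars A' = map snd Q" "matrix A' = strip E"
    "free_vars A' = free_vars (strip E) - snd ` set Q"
    unfolding A'_def by (simp_all add: quantify_simps)
  have ys: "set ys = {y. (False, y) \<in> set Q}"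
    unfolding ys_def A'_def by (auto simp: ex_scopes_quantify(1) image_iff)
  have E_vars: "free_vars E \<subseteq> {..<m}" "set (bound_vars E) \<subseteq> {m..}"
    using free_vars_expand[of m K "[]" id A] vars bound_vars_expand(2)[of _ m K "[]" id A]
    unfolding E_def all_vars_def by auto
  have expansion: "strong_or_expansion A E"
    unfolding E_def by (rule strong_or_expansion_expand[OF vars])
  have normal: "alpha_normal A'"
    unfolding alpha_normal_def A'(1) using Q(1) strict_sorted_iff by blast
  have prenex: "prenex A'" by (simp add: prenex_def quantifier_free_def A'(2))
  have "set (bound_vars E) \<inter> free_vars E = {}"
    using E_vars by (meson disjoint_iff atLeast_iff leD lessThan_iff subsetD)
  then have prenexification: "prenexification E A'"
    unfolding prenexification_def alpha_normal_def bound_free_disjoint_def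
    using distinct Q(3) prenex unfolding A'_def by blast
  have "witnessing_substitution S A' ts"
    unfolding witnessing_substitution_def
  proof (intro conjI allI impI)
    show "alpha_normal A'" "prenex A'" by (fact normal prenex)+
    show "bound_free_disjoint A'" by (auto simp: bound_free_disjoint_def A')
    show "length ts = length (ex_scopes {} A')" by (simp add: ts_def ys_def)
  next
    fix i assume "i < length ts"
    then have i: "i < length (ex_scopes {} A')" by (simp add: ts_def ys_def)
    obtain y Y where yY: "ex_scopes {} A' ! i = (y, Y)" by fastforce
    then have "(y, Y) \<in> set (ex_scopes {} A')" using i nth_mem by metis
    then have Y: "{x. (True, x) \<in> set Q \<and> x < y} \<subseteq> Y" and "y \<in> set ys"
      using ex_scopes_quantify(2)[OF bound_vars_strip Q(1)] unfolding A'_def ys_def by force+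
    then have "(False, y) \<in> set (quants E)" using ys Q(2) by blast
    then obtain r where "below [] r" "y = ex_name m r"
      using quants_expand[of False y] unfolding E_def by fastforce
    then obtain j p where jp: "y = ex_name m (j # p)"
      unfolding below_def by (cases r) auto
    have ti: "ts ! i = T j"
      using i yY jp by (simp add: ts_def ys_def)
    show "wf_trm S (ts ! i)" unfolding ti by (rule wf)
    show "vars_trm (ts ! i) \<inter> set (bound_vars A') \<subseteq> snd (ex_scopes {} A' ! i)"
    proof
      fix x assume "x \<in> vars_trm (ts ! i) \<inter> set (bound_vars A')"
      then have x: "x \<in> vars_trm (T j)" and "x \<in> snd ` set Q" by (auto simp: ti A')
      then obtain q where q: "(q, x) \<in> set Q" by auto
      have "x < y"
        using T[OF x] list_encode_Cons_gt(1)[of j p] unfolding jp ex_name_def by linarith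
      moreover have q
        using bound_vars_expand_kind T[OF x] q unfolding Q(2) E_def by blast
      ultimately show "x \<in> snd (ex_scopes {} A' ! i)" using Y q by (auto simp: yY)
    qed
  next
    \<comment> \<open>\<open>witness m T\<close> also moves existential names outside of \<open>ys\<close>; these do not occur in the matrix.\<close>
    have subst: "subst_fm (subst_of ys ts) (strip E) = subst_fm (witness m T) (strip E)"
    proof (rule subst_fm_cong)
      fix x assume "x \<in> free_vars (strip E)"
      then have x: "x < m \<or> (\<exists>q. (q, x) \<in> set Q)"
        using free_vars_strip[of E] E_vars(1) unfolding Q(2) bound_vars_quants by fastforce
      have not_ex: "\<not> is_ex_name m x" if "x \<notin> set ys"
        using x
      proof
        assume "\<exists>q. (q, x) \<in> set Q"
        then obtain q where q: "(q, x) \<in> set Q" ..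
        then have q using that unfolding ys by (cases q) simp_all
        then show ?thesis using bound_vars_expand_kind q unfolding Q(2) E_def by blast
      qed (simp add: is_ex_name_def)
      show "subst_of ys ts x = witness m T x"
      proof (cases "x \<in> set ys")
        case True
        then show ?thesis by (simp add: subst_of_def ts_def map_of_zip_map)
      next
        case False
        then show ?thesis using not_ex by (simp add: subst_of_def ts_def map_of_zip_map witness_def)
      qed
    qed
    have "prop_eval v (subst_fm (witness m T) (strip E))" for v
      unfolding E_def prop_eval_strip_expand using holds by simp
    then show "tautology (subst_fm (subst_of (map fst (ex_scopes {} A')) ts) (matrix A'))"
      by (simp add: tautology_def quantifier_free_def A'(2) subst ys_def[symmetric])
  qed
  then show ?thesis using expansion prenexification unfolding herbrand_proof_def by blast
qed


section \<open>Compactness\<close>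

text \<open>
  More copies only add disjuncts. The paths do not mention \<open>K\<close>, so the instances for \<open>K\<close> literally reappear in
  those for \<open>K'\<close>, with the same eigenvariables.
\<close>

lemma holds_mono: "holds m T v K p \<sigma> A \<Longrightarrow> K \<le> K' \<Longrightarrow> holds m T v K' p \<sigma> A"
proof (induction A arbitrary: p \<sigma>)
  case (Ex x A)
  then show ?case by (metis holds.simps(6) order_trans)
qed auto

text \<open>
  \<open>P\<close> depends only on the truth values of the atoms in \<open>X\<close>.
\<close>

definition supports :: "('p \<times> 'a) set \<Rightarrow> (('p \<Rightarrow> 'a \<Rightarrow> bool) \<Rightarrow> bool) \<Rightarrow> bool" where
  "supports X P \<longleftrightarrow> (\<forall>v w. (\<forall>(q, ts)\<in>X. v q ts = w q ts) \<longrightarrow> P v = P w)"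

lemma supports_mono: "supports X P \<Longrightarrow> X \<subseteq> Y \<Longrightarrow> supports Y P"
  unfolding supports_def by (meson subsetD)

lemma supports_connectives:
  assumes "supports X P" "supports X Q"
  shows "supports X (\<lambda>v. P v \<and> Q v)" "supports X (\<lambda>v. P v \<or> Q v)"
  unfolding supports_def
proof -
  have "P v = P w \<and> Q v = Q w" if "\<forall>(q, ts)\<in>X. v q ts = w q ts" for v w
    using assms that unfolding supports_def by blast
  then show "\<forall>v w. (\<forall>(q, ts)\<in>X. v q ts = w q ts) \<longrightarrow> (P v \<and> Q v) = (P w \<and> Q w)"
    "\<forall>v w. (\<forall>(q, ts)\<in>X. v q ts = w q ts) \<longrightarrow> (P v \<or> Q v) = (P w \<or> Q w)"
    by blast+
qed

lemma supports_Ex: "(\<And>i. i \<le> n \<Longrightarrow> supports X (P i)) \<Longrightarrow> supports X (\<lambda>v. \<exists>i\<le>n. P i v)"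
  unfolding supports_def by meson

lemma holds_finite_support: "\<exists>X. finite X \<and> supports X (\<lambda>v. holds m T v K p \<sigma> A)"
proof (induction A arbitrary: p \<sigma>)
  case (Pos q ts)
  show ?case by (rule exI[of _ "{(q, map (subst_trm \<sigma>) ts)}"]) (auto simp: supports_def)
next
  case (Neg q ts)
  show ?case by (rule exI[of _ "{(q, map (subst_trm \<sigma>) ts)}"]) (auto simp: supports_def)
next
  case (And A B)
  obtain X where X: "finite X" "supports X (\<lambda>v. holds m T v K (0 # p) \<sigma> A)"
    using And.IH(1)[of "0 # p" \<sigma>] by (elim exE conjE)
  obtain Y where Y: "finite Y" "supports Y (\<lambda>v. holds m T v K (1 # p) \<sigma> B)"
    using And.IH(2)[of "1 # p" \<sigma>] by (elim exE conjE)
  have "supports (X \<union> Y) (\<lambda>v. holds m T v K p \<sigma> (And A B))"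
    unfolding holds.simps
    by (intro supports_connectives supports_mono[OF X(2)] supports_mono[OF Y(2)]) auto
  with X(1) Y(1) show ?case by (intro exI[of _ "X \<union> Y"]) simp
next
  case (Or A B)
  obtain X where X: "finite X" "supports X (\<lambda>v. holds m T v K (0 # p) \<sigma> A)"
    using Or.IH(1)[of "0 # p" \<sigma>] by (elim exE conjE)
  obtain Y where Y: "finite Y" "supports Y (\<lambda>v. holds m T v K (1 # p) \<sigma> B)"
    using Or.IH(2)[of "1 # p" \<sigma>] by (elim exE conjE)
  have "supports (X \<union> Y) (\<lambda>v. holds m T v K p \<sigma> (Or A B))"
    unfolding holds.simps
    by (intro supports_connectives supports_mono[OF X(2)] supports_mono[OF Y(2)]) auto
  with X(1) Y(1) show ?case by (intro exI[of _ "X \<union> Y"]) simp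
next
  case (All x A)
  show ?case unfolding holds.simps by (rule All.IH)
next
  case (Ex x A)
  have "\<forall>i. \<exists>X. finite X \<and> supports X (\<lambda>v. holds m T v K (i # p) (\<sigma>(x := T i)) A)"
    by (intro allI Ex.IH)
  from choice[OF this] obtain X where
    X: "\<forall>i. finite (X i) \<and> supports (X i) (\<lambda>v. holds m T v K (i # p) (\<sigma>(x := T i)) A)" ..
  have "supports (\<Union>i\<le>K. X i) (\<lambda>v. holds m T v K p \<sigma> (Ex x A))"
    unfolding holds.simps
  proof (rule supports_Ex)
    fix i assume "i \<le> K"
    then have "X i \<subseteq> (\<Union>i\<le>K. X i)" by auto
    with X[THEN spec, THEN conjunct2]
    show "supports (\<Union>i\<le>K. X i) (\<lambda>v. holds m T v K (i # p) (\<sigma>(x := T i)) A)"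
      by (rule supports_mono)
  qed
  moreover have "finite (\<Union>i\<le>K. X i)"
    by (rule finite_UN_I[OF finite_atMost X[THEN spec, THEN conjunct1]])
  ultimately show ?case by (intro exI[of _ "\<Union>i\<le>K. X i"] conjI)
qed

text \<open>
  Repeated bisection as in the Bolzano-Weierstrass theorem: from the indices that are left, keep those
  whose sequence takes one fixed value at position \<open>n\<close>, with the value chosen such that infinitely many
  remain.
\<close>

primrec thin_out :: "(nat \<Rightarrow> nat \<Rightarrow> bool) \<Rightarrow> nat \<Rightarrow> nat set" where
  "thin_out V 0 = UNIV"
| "thin_out V (Suc n) =
    (if infinite {K \<in> thin_out V n. V K n} then {K \<in> thin_out V n. V K n}
     else {K \<in> thin_out V n. \<not> V K n})"

lemma infinite_thin_out: "infinite (thin_out V n)"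
proof (induction n)
  case (Suc n)
  have "thin_out V n = {K \<in> thin_out V n. V K n} \<union> {K \<in> thin_out V n. \<not> V K n}" by blast
  with Suc show ?case by (metis finite_Un thin_out.simps(2))
qed simp

lemma limit_of_bool_sequences:
  fixes V :: "nat \<Rightarrow> nat \<Rightarrow> bool"
  shows "\<exists>w. \<forall>n. infinite {K. \<forall>i<n. V K i = w i}"
proof (intro exI allI)
  fix n
  have "K \<in> thin_out V n \<Longrightarrow> \<forall>i<n. V K i = infinite {K \<in> thin_out V i. V K i}" for K
    by (induction n) (auto simp: less_Suc_eq split: if_splits)
  then have "thin_out V n \<subseteq> {K. \<forall>i<n. V K i = infinite {K \<in> thin_out V i. V K i}}" by blast
  then show "infinite {K. \<forall>i<n. V K i = (\<lambda>i. infinite {K \<in> thin_out V i. V K i}) i}"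
    using infinite_thin_out infinite_super by blast
qed

text \<open>
  Only countably many atoms matter for all \<open>K\<close> together, so the falsifying valuations for the
  different \<open>K\<close> are sequences of truth values, and \<open>v\<close> is a limit of them. For given \<open>K\<close>, some valuation
  that falsifies a later stage \<open>K'\<close> agrees with \<open>v\<close> on the finitely many atoms of stage \<open>K\<close>; by
  monotonicity it falsifies stage \<open>K\<close>, and hence so does \<open>v\<close>.
\<close>

lemma uniform_countervaluation:
  assumes "\<And>K. \<exists>v. \<not> holds m T v K p \<sigma> A"
  shows "\<exists>v. \<forall>K. \<not> holds m T v K p \<sigma> A"
proof -
  have "\<forall>K. \<exists>v. \<not> holds m T v K p \<sigma> A" using assms by (rule allI)
  from choice[OF this] obtain V where V: "\<forall>K. \<not> holds m T (V K) K p \<sigma> A" ..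
  have "\<forall>K. \<exists>X. finite X \<and> supports X (\<lambda>v. holds m T v K p \<sigma> A)"
    by (intro allI holds_finite_support)
  from choice[OF this] obtain X where
    X: "\<forall>K. finite (X K) \<and> supports (X K) (\<lambda>v. holds m T v K p \<sigma> A)" ..
  define At where "At = (\<Union>K. X K)"
  have At: "countable At" unfolding At_def using X by (simp add: countable_finite)
  define V' where "V' K n = (case from_nat_into At n of (q, ts) \<Rightarrow> V K q ts)" for K n
  obtain w where w: "\<And>n. infinite {K. \<forall>i<n. V' K i = w i}"
    using limit_of_bool_sequences[of V'] by blast
  define v where "v q ts = w (to_nat_on At (q, ts))" for q ts
  have "\<not> holds m T v K p \<sigma> A" for K
  proof -
    obtain n where n: "to_nat_on At ` X K \<subseteq> {..<n}"
      using X finite_imageI[of "X K" "to_nat_on At"] finite_nat_iff_bounded by blast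
    obtain K' where K': "K \<le> K'" "\<forall>i<n. V' K' i = w i"
      using w[of n] unfolding infinite_nat_iff_unbounded_le by blast
    have "V K' q ts = v q ts" if "(q, ts) \<in> X K" for q ts
    proof -
      have "(q, ts) \<in> At" using that unfolding At_def by blast
      then have "V' K' (to_nat_on At (q, ts)) = V K' q ts"
        unfolding V'_def by (simp add: At)
      moreover have "to_nat_on At (q, ts) < n" using n that by blast
      ultimately show ?thesis using K'(2) unfolding v_def by blast
    qed
    then have "\<forall>(q, ts)\<in>X K. v q ts = V K' q ts" by auto
    moreover have "supports (X K) (\<lambda>v. holds m T v K p \<sigma> A)" using X by simp
    ultimately have "holds m T v K p \<sigma> A = holds m T (V K') K p \<sigma> A"
      unfolding supports_def by (simp only: simp_thms)
    moreover have "\<not> holds m T (V K') K p \<sigma> A"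
      using V holds_mono[OF _ K'(1)] by blast
    ultimately show ?thesis by simp
  qed
  then show ?thesis by blast
qed


section \<open>Coding of terms\<close>

fun encode_trm :: "('f \<Rightarrow> nat) \<Rightarrow> 'f trm \<Rightarrow> nat" where
  "encode_trm num (Var x) = prod_encode (0, x)"
| "encode_trm num (Fn f ts) = prod_encode (Suc (num f), list_encode (map (encode_trm num) ts))"

lemma encode_trm_inj:
  assumes "inj_on num F"
  shows "set_trm s \<subseteq> F \<Longrightarrow> set_trm t \<subseteq> F \<Longrightarrow> encode_trm num s = encode_trm num t \<Longrightarrow> s = t"
proof (induction s arbitrary: t)
  case (Var x)
  then show ?case by (cases t) auto
next
  case (Fn f ts)
  then obtain g us where t: "t = Fn g us" by (cases t) auto
  have "num f = num g" "f \<in> F" "g \<in> F" using Fn.prems t by auto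
  then have "f = g" by (rule inj_onD[OF assms])
  have "map (encode_trm num) ts = map (encode_trm num) us"
    using Fn.prems(3) t by (simp add: list_encode_eq)
  then have "list_all2 (\<lambda>s t. encode_trm num s = encode_trm num t) ts us"
    by (simp add: list_all2_conv_all_nth list_eq_iff_nth_eq)
  then have "list_all2 (=) ts us"
  proof (rule list.rel_mono_strong)
    fix s u assume "s \<in> set ts" "u \<in> set us" "encode_trm num s = encode_trm num u"
    moreover from this have "set_trm s \<subseteq> F" "set_trm u \<subseteq> F" using Fn.prems(1,2) t by auto
    ultimately show "s = u" using Fn.IH by blast
  qed
  with \<open>f = g\<close> t show ?case by (simp add: list.rel_eq)
qed

lemma le_list_encode: "x \<in> set xs \<Longrightarrow> x \<le> list_encode xs"
proof (induction xs)
  case (Cons y ys)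
  have "y \<le> list_encode (y # ys)" "list_encode ys \<le> list_encode (y # ys)"
    using list_encode_Cons_gt less_imp_le by blast+
  with Cons show ?case using le_trans by (cases "x = y") auto
qed simp

text \<open>
  Enumerating terms along this code makes the variables of the term number \<open>n\<close> at most \<open>n\<close>, as the naming
  scheme demands.
\<close>

lemma vars_le_encode_trm: "z \<in> vars_trm t \<Longrightarrow> z \<le> encode_trm num t"
proof (induction t)
  case (Var x)
  then show ?case by (simp add: le_prod_encode_2)
next
  case (Fn f ts)
  then obtain t where t: "t \<in> set ts" "z \<le> encode_trm num t" by auto
  then have "z \<le> list_encode (map (encode_trm num) ts)"
    using le_list_encode[of "encode_trm num t" "map (encode_trm num) ts"] by simp
  also have "\<dots> \<le> encode_trm num (Fn f ts)" by (simp add: le_prod_encode_2)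
  finally show ?case .
qed


section \<open>The term model\<close>

text \<open>
  The map \<open>code\<close> transports the model of the terms \<open>D\<close> to another type. Only the function symbols in \<open>F\<close>
  act by term formation; keeping \<open>F\<close> finite is what allows \<open>D\<close> to be countable although the signature
  may be uncountable.
\<close>

locale term_model =
  fixes S :: "('f, 'p) signature" and F :: "'f set" and D :: "'f trm set"
    and code :: "'f trm \<Rightarrow> 'u" and v :: "'p \<Rightarrow> 'f trm list \<Rightarrow> bool"
  assumes nonempty: "D \<noteq> {}"
    and closed: "f \<in> F \<Longrightarrow> length ts = fun_arity S f \<Longrightarrow> set ts \<subseteq> D \<Longrightarrow> Fn f ts \<in> D"
    and inj: "inj_on code D"
begin

definition decode :: "'u \<Rightarrow> 'f trm" where
  "decode = inv_into D code"

definition model :: "('f, 'p, 'u) interp" where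
  "model = \<lparr>universe = code ` D,
    fn = \<lambda>f us. if f \<in> F then code (Fn f (map decode us)) else code (SOME t. t \<in> D),
    rel = \<lambda>q us. v q (map decode us)\<rparr>"

lemma model_simps:
  "universe model = code ` D"
  "f \<in> F \<Longrightarrow> fn model f us = code (Fn f (map decode us))"
  "f \<notin> F \<Longrightarrow> fn model f us = code (SOME t. t \<in> D)"
  "rel model q us = v q (map decode us)"
  by (simp_all add: model_def)

lemma decode_code: "t \<in> D \<Longrightarrow> decode (code t) = t"
  unfolding decode_def using inj by simp

lemma is_interp_model: "is_interp S model"
proof -
  have "code (Fn f (map decode us)) \<in> code ` D"
    if "f \<in> F" "length us = fun_arity S f" "set us \<subseteq> code ` D" for f us
  proof (rule imageI, rule closed[OF that(1)])
    show "set (map decode us) \<subseteq> D" using that(3) decode_code by fastforce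
  qed (simp add: that)
  moreover have "code (SOME t. t \<in> D) \<in> code ` D"
    using nonempty by (simp add: some_in_eq)
  ultimately have "fn model f us \<in> universe model"
    if "length us = fun_arity S f" "set us \<subseteq> universe model" for f us
    using that by (cases "f \<in> F") (simp_all add: model_simps)
  then show ?thesis using nonempty by (simp add: is_interp_def model_simps)
qed

lemma eval_model:
  assumes "range \<sigma> \<subseteq> D"
  shows "wf_trm S t \<Longrightarrow> set_trm t \<subseteq> F \<Longrightarrow>
    subst_trm \<sigma> t \<in> D \<and> eval model (code \<circ> \<sigma>) t = code (subst_trm \<sigma> t)"
proof (induction t)
  case (Var x)
  then show ?case using assms by auto
next
  case (Fn f ts)
  then have *: "subst_trm \<sigma> t \<in> D" "eval model (code \<circ> \<sigma>) t = code (subst_trm \<sigma> t)"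
    if "t \<in> set ts" for t
    using that by fastforce+
  have "map decode (map (eval model (code \<circ> \<sigma>)) ts) = map (subst_trm \<sigma>) ts"
    using * by (simp add: decode_code)
  moreover have "f \<in> F" using Fn.prems by simp
  moreover have "subst_trm \<sigma> (Fn f ts) \<in> D"
    using closed[of f "map (subst_trm \<sigma>) ts"] Fn.prems * by auto
  ultimately show ?case by (simp only: eval.simps subst_trm.simps model_simps simp_thms)
qed

lemma decode_eval_model:
  assumes "range \<sigma> \<subseteq> D" "\<forall>t\<in>set ts. wf_trm S t \<and> set_trm t \<subseteq> F"
  shows "map decode (map (eval model (code \<circ> \<sigma>)) ts) = map (subst_trm \<sigma>) ts"
proof -
  have "decode (eval model (code \<circ> \<sigma>) t) = subst_trm \<sigma> t" if "t \<in> set ts" for t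
    using eval_model[OF assms(1), of t] assms(2) that decode_code by metis
  then show ?thesis by simp
qed

text \<open>
  The hypothesis on all \<open>K\<close> passes to the subformulae. For a conjunction this uses monotonicity: if each
  conjunct held at some stage, both would hold at the later of the two stages. For an existential, every
  element of the model is some \<open>T i\<close>, whose instance occurs in all stages from \<open>i\<close> on.
\<close>

lemma model_falsifies:
  assumes "wf_fm S A" "set1_fm A \<subseteq> F" "range \<sigma> \<subseteq> D"
    and T: "range T = D" and all_names: "\<And>p. Var (all_name m p) \<in> D"
    and "\<And>K. \<not> holds m T v K p \<sigma> A"
  shows "\<not> sat model (code \<circ> \<sigma>) A"
  using assms(1-3,6)
proof (induction A arbitrary: p \<sigma>)
  case (Pos q ts)
  have "map decode (map (eval model (code \<circ> \<sigma>)) ts) = map (subst_trm \<sigma>) ts"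
    by (rule decode_eval_model) (use Pos.prems in auto)
  with Pos.prems(4)[of 0] show ?case by (simp only: sat.simps model_simps holds.simps simp_thms)
next
  case (Neg q ts)
  have "map decode (map (eval model (code \<circ> \<sigma>)) ts) = map (subst_trm \<sigma>) ts"
    by (rule decode_eval_model) (use Neg.prems in auto)
  with Neg.prems(4)[of 0] show ?case by (simp only: sat.simps model_simps holds.simps simp_thms)
next
  case (And A B)
  have "(\<forall>K. \<not> holds m T v K (0 # p) \<sigma> A) \<or> (\<forall>K. \<not> holds m T v K (1 # p) \<sigma> B)"
  proof (rule ccontr)
    assume "\<not> ?thesis"
    then obtain K L where "holds m T v K (0 # p) \<sigma> A" "holds m T v L (1 # p) \<sigma> B" by blast
    then have "holds m T v (max K L) p \<sigma> (And A B)"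
      using holds_mono max.cobounded1 max.cobounded2 by (metis holds.simps(3))
    with And.prems(4) show False by blast
  qed
  then show ?case
  proof
    assume "\<forall>K. \<not> holds m T v K (0 # p) \<sigma> A"
    then have "\<not> sat model (code \<circ> \<sigma>) A"
      by (intro And.IH(1)[where p = "0 # p"]) (use And.prems in auto)
    then show ?thesis unfolding sat.simps by blast
  next
    assume "\<forall>K. \<not> holds m T v K (1 # p) \<sigma> B"
    then have "\<not> sat model (code \<circ> \<sigma>) B"
      by (intro And.IH(2)[where p = "1 # p"]) (use And.prems in auto)
    then show ?thesis unfolding sat.simps by blast
  qed
next
  case (Or A B)
  have "\<not> sat model (code \<circ> \<sigma>) A"
    by (rule Or.IH(1)[where p = "0 # p"]) (use Or.prems in auto)
  moreover have "\<not> sat model (code \<circ> \<sigma>) B"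
    by (rule Or.IH(2)[where p = "1 # p"]) (use Or.prems in auto)
  ultimately show ?case unfolding sat.simps by blast
next
  case (All x A)
  let ?t = "Var (all_name m (0 # p))"
  have "\<not> sat model (code \<circ> \<sigma>(x := ?t)) A"
  proof (rule All.IH)
    show "range (\<sigma>(x := ?t)) \<subseteq> D" using All.prems(3) all_names by auto
    show "\<not> holds m T v K (0 # p) (\<sigma>(x := ?t)) A" for K
      using All.prems(4)[of K] unfolding holds.simps .
  qed (use All.prems in simp_all)
  then show ?case
    using all_names[of "0 # p"] unfolding fun_upd_comp sat.simps model_simps by blast
next
  case (Ex x A)
  have "\<not> sat model ((code \<circ> \<sigma>)(x := u)) A" if u_in: "u \<in> universe model" for u
  proof -
    obtain i where u: "u = code (T i)"
      using u_in T by (auto simp: model_simps)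
    have not_holds: "\<not> holds m T v K (i # p) (\<sigma>(x := T i)) A" for K
    proof
      assume "holds m T v K (i # p) (\<sigma>(x := T i)) A"
      then have "holds m T v (max i K) p \<sigma> (Ex x A)"
        using holds_mono max.cobounded1 max.cobounded2 by (metis holds.simps(6))
      with Ex.prems(4) show False by blast
    qed
    have "\<not> sat model (code \<circ> \<sigma>(x := T i)) A"
    proof (rule Ex.IH)
      show "range (\<sigma>(x := T i)) \<subseteq> D" using Ex.prems(3) T by auto
      show "\<not> holds m T v K (i # p) (\<sigma>(x := T i)) A" for K by (rule not_holds)
    qed (use Ex.prems in simp_all)
    then show ?thesis unfolding fun_upd_comp u .
  qed
  then show ?case unfolding sat.simps by blast
qed

end


section \<open>Herbrand's theorem\<close>

lemma finite_set_trm: "finite (set_trm t)"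
  by (induction t) auto

lemma finite_all_vars_and_symbols: "finite (all_vars A)" "finite (set1_fm A)"
proof -
  have "finite (vars_trm t)" for t :: "'a trm" by (induction t) auto
  then show "finite (all_vars A)" "finite (set1_fm A)"
    unfolding all_vars_def by (induction A) (auto simp: finite_set_trm)
qed

lemma herbrand_proof_of_valid:
  fixes S :: "('f, 'p) signature"
  assumes const: "\<exists>c. fun_arity S c = 0"
    and wf: "wf_fm S A"
    and inf: "infinite (UNIV :: 'u set)"
    and valid: "valid TYPE('u) S A"
  shows "\<exists>A' ts. herbrand_proof S A A' ts"
proof -
  obtain c where c: "fun_arity S c = 0" using const by blast
  obtain m where m: "all_vars A \<subseteq> {..<m}"
    using finite_all_vars_and_symbols(1)[of A] finite_nat_iff_bounded by blast
  define F where "F = insert c (set1_fm A)"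
  obtain num :: "'f \<Rightarrow> nat" where num: "inj_on num F"
    using finite_imp_inj_to_nat_seg[of F] finite_all_vars_and_symbols(2)[of A] unfolding F_def by auto
  define D where
    "D = {t. wf_trm S t \<and> set_trm t \<subseteq> F \<and> (\<forall>z\<in>vars_trm t. \<not> is_ex_name m z)}"
  \<comment> \<open>Numbers that encode no term of \<open>D\<close> are mapped to the constant: it is in \<open>D\<close> and has no variables.\<close>
  define T where "T n = (if n \<in> encode_trm num ` D then inv_into D (encode_trm num) n else Fn c [])" for n
  have inj: "inj_on (encode_trm num) D"
    by (rule inj_onI) (use encode_trm_inj[OF num] D_def in blast)
  have c_D: "Fn c [] \<in> D" by (simp add: D_def F_def c)
  have T_D: "T n \<in> D" for n
    using c_D by (simp add: T_def inv_into_into)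
  have "T (encode_trm num t) = t" if "t \<in> D" for t
    using that inj by (simp add: T_def)
  then have range_T: "range T = D" using T_D by (metis image_subset_iff rangeI subsetI subset_antisym)
  have T_vars: "z \<le> n \<and> \<not> is_ex_name m z" if z: "z \<in> vars_trm (T n)" for n z
  proof
    show "z \<le> n"
    proof (cases "n \<in> encode_trm num ` D")
      case True
      then show ?thesis
        using vars_le_encode_trm[OF z, of num] by (simp add: T_def f_inv_into_f)
    qed (use z in \<open>simp add: T_def\<close>)
    show "\<not> is_ex_name m z" using T_D[of n] z by (auto simp: D_def)
  qed
  show ?thesis
  proof (cases "\<exists>K. \<forall>v. holds m T v K [] (witness m T) A")
    case True
    then obtain K where "\<And>v. holds m T v K [] (witness m T) A" by blast
    then show ?thesis
      using herbrand_proof_of_holds[OF m, of S T K] T_D T_vars unfolding D_def by blast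
  next
    case False
    then obtain v where v: "\<And>K. \<not> holds m T v K [] (witness m T) A"
      using uniform_countervaluation[of m T "[]" "witness m T" A] by blast
    obtain h :: "nat \<Rightarrow> 'u" where h: "inj h"
      using infinite_countable_subset[OF inf] by blast
    interpret term_model S F D "h \<circ> encode_trm num" v
    proof
      show "D \<noteq> {}" using c_D by blast
      show "f \<in> F \<Longrightarrow> length ts = fun_arity S f \<Longrightarrow> set ts \<subseteq> D \<Longrightarrow> Fn f ts \<in> D" for f ts
        by (auto simp: D_def)
      show "inj_on (h \<circ> encode_trm num) D"
        using comp_inj_on[OF inj] h inj_on_subset by blast
    qed
    have witness_D: "range (witness m T) \<subseteq> D"
      using T_D by (auto simp: witness_def D_def)
    have "\<not> sat model ((h \<circ> encode_trm num) \<circ> witness m T) A"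
      by (rule model_falsifies[OF wf _ witness_D range_T _ v]) (auto simp: F_def D_def)
    moreover have "range ((h \<circ> encode_trm num) \<circ> witness m T) \<subseteq> universe model"
      using witness_D by (auto simp: model_simps)
    ultimately show ?thesis using valid is_interp_model unfolding valid_def by blast
  qed
qed

theorem theorem15:
  fixes S :: "('f, 'p) signature"
    and A :: "('f, 'p) fm"
  assumes const: "\<exists>c. fun_arity S c = 0"
    and wf: "wf_fm S A"
    and inf: "infinite (UNIV :: 'u set)"
  shows "valid TYPE('u) S A \<longleftrightarrow> (\<exists>A' ts. herbrand_proof S A A' ts)"
  using herbrand_proof_of_valid[OF const wf inf] valid_of_herbrand_proof by blast

end
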